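(* Let $\mathcal{H}$ be a real Hilbert space, let $S:\mathcal{H}\to 2^{\mathcal{H}}$ be maximal monotone, let $T:\mathcal{H}\to\mathcal{H}$ be monotone and Lipschitz continuous with constant $\mathsf{L}>0$, and assume that $(S+T)^{-1}(0)$ is nonempty. Let $U:\mathcal{H}\to\mathcal{H}$ be a contraction with constant $\bar{\kappa}\in[0,\frac12)$. Let $\delta_0,\delta_1>0$, $\bar{\beta}\in(0,\frac14)$, $\bar{r}\in\left(\bar{\beta},\frac{1-2\bar{\beta}}{2}\right)$, let $\{\sigma_n\}_{n\ge1}$ be a sequence in $(0,1)$ and $\{c_n\}_{n\ge1}$ a sequence in $[0,\infty)$ with $\sum_{n=1}^\infty c_n<\infty$. For arbitrary $w_0,w_1\in\mathcal{H}$, let $\{w_n\}$ be generated by $$w_{n+1}=J^{S}_{\delta_n}\big(\sigma_nUw_n+(1-\sigma_n)w_n-\delta_nTw_n-\delta_{n-1}(1-\sigma_n(1-2\bar{\kappa}))(Tw_n-Tw_{n-1})\big),\quad n\ge1,$$ where, for $n\ge 1$, $$\delta_{n+1}=\begin{cases}\min\left\{\dfrac{\bar{r}\|w_n-w_{n+1}\|}{\|Tw_n-Tw_{n+1}\|},\ \delta_n+c_n\right\},&\text{if }Tw_n\ne Tw_{n+1},\\ \delta_n+c_n,&\text{otherwise.}\end{cases}$$ If $\lim_{n\to\infty}\sigma_n=0$ and $\sum_{n=1}^\infty\sigma_n=\infty$, then $\{w_n\}$ converges strongly (i.e., in norm) to the point $\widehat{w}\in\mathcal{H}$ satisfying $\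widehat{w}=P_{(S+T)^{-1}(0)}U\widehat{w}$.
   Context: $(S+T)^{-1}(0)=\{w\in\mathcal{H}: 0\in Sw+Tw\}$. For $\delta>0$, $J^S_\delta=(I_{\mathcal{H}}+\delta S)^{-1}$ is the resolvent of $S$, which is single-valued and everywhere defined when $S$ is maximal monotone. A set-valued operator $S$ is monotone if $\langle \hat a-\hat b,a-b\rangle\ge0$ for all $a,b\in\mathcal{H}$, $\hat a\in Sa$, $\hat b\in Sb$, and maximal monotone if, in addition, its graph is not properly contained in the graph of any other monotone operator. $T$ is monotone if $\langle Ta-Tb,a-b\rangle\ge0$ for all $a,b$, and Lipschitz continuous with constant $\mathsf{L}$ if $\|Ta-Tb\|\le\mathsf{L}\|a-b\|$ for all $a,b$. $U$ is a contraction with constant $\bar\kappa$ if $\|Ua-Ub\|\le\bar\kappa\|a-b\|$ for all $a,b\in\mathcal{H}$. $P_C$ denotes the metric projection onto a nonempty closed convex set $C\subseteq\mathcal{H}$ (the set $(S+T)^{-1}(0)$ is closed and convex because $S+T$ is maximal monotone). Since $P_{(S+T)^{-1}(0)}\circ U$ is a contraction with constant less than $1$, it has a unique fixed point. *)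

theory Defs
  imports "HOL-Analysis.Analysis"
begin

text \<open>
  A set-valued operator on H is a function \<open>S :: 'a \<Rightarrow> 'a set\<close>; its graph is
  \<open>Sigma UNIV S\<close>, the set of all \<open>(a, u)\<close> with \<open>u \<in> S a\<close>. A real Hilbert space is a type
  of sort \<open>{real_inner, complete_space}\<close>.
\<close>

definition monotone_operator :: "('a::real_inner \<Rightarrow> 'a set) \<Rightarrow> bool" where
  "monotone_operator S \<longleftrightarrow> (\<forall>a b. \<forall>u\<in>S a. \<forall>v\<in>S b. inner (u - v) (a - b) \<ge> 0)"

definition maximal_monotone :: "('a::real_inner \<Rightarrow> 'a set) \<Rightarrow> bool" where
  "maximal_monotone S \<longleftrightarrow> monotone_operator S \<and>
     (\<forall>S'. monotone_operator S' \<longrightarrow> \<not> Sigma UNIV S \<subset> Sigma UNIV S')"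

definition monotone_point_map :: "('a::real_inner \<Rightarrow> 'a) \<Rightarrow> bool" where
  "monotone_point_map T \<longleftrightarrow> (\<forall>a b. inner (T a - T b) (a - b) \<ge> 0)"

definition operator_inverse :: "('a \<Rightarrow> 'a set) \<Rightarrow> 'a \<Rightarrow> 'a set" where
  "operator_inverse S y = {x. y \<in> S x}"

definition operator_plus :: "('a::real_vector \<Rightarrow> 'a set) \<Rightarrow> ('a \<Rightarrow> 'a) \<Rightarrow> 'a \<Rightarrow> 'a set" where
  "operator_plus S T x = {u + T x |u. u \<in> S x}"

definition operator_scale :: "real \<Rightarrow> ('a::real_vector \<Rightarrow> 'a set) \<Rightarrow> 'a \<Rightarrow> 'a set" where
  "operator_scale d S x = {d *\<^sub>R u |u. u \<in> S x}"

text \<open>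
  The inverse of \<open>I + d S\<close> is read as a point-valued map. It is meaningful only where that
  inverse is a singleton, which for \<open>d > 0\<close> and maximal monotone \<open>S\<close> on a Hilbert space
  is everywhere (Minty).
\<close>

definition resolvent :: "('a::real_inner \<Rightarrow> 'a set) \<Rightarrow> real \<Rightarrow> 'a \<Rightarrow> 'a" where
  "resolvent S d y = the_elem (operator_inverse (operator_plus (operator_scale d S) id) y)"

text \<open>
  The library's \<open>closest_point\<close> requires \<open>heine_borel\<close>, that is, finite dimension. The
  description below is meaningful for nonempty closed convex \<open>C\<close> in a Hilbert space.
\<close>

definition metric_projection :: "'a::real_inner set \<Rightarrow> 'a \<Rightarrow> 'a" where
  "metric_projection C x = (THE p. p \<in> C \<and> (\<forall>y\<in>C. dist x p \<le> dist x y))"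

end

theory Submission
  imports Defs
begin

text \<open>
  With \<open>A n = T (w n) - T (w (n - 1))\<close> and the projected fixed point \<open>p\<close>, the quantity
  \<open>\<Gamma> n = \<parallel>w n - p\<parallel>\<^sup>2 - 2 \<delta>\<^sub>n\<^sub>-\<^sub>1 \<langle>A n, w n - p\<rangle> + s \<parallel>w n - w (n - 1)\<parallel>\<^sup>2\<close> is at least half of
  \<open>\<parallel>w n - p\<parallel>\<^sup>2\<close> and satisfies
  \<open>\<Gamma> (n + 1) + h D n \<le> (1 - (1 - 2\<kappa>) \<sigma> n) \<Gamma> n + 2 \<sigma> n \<langle>U p - p, w (n + 1) - p\<rangle>\<close>, where \<open>D n\<close> is the sum of
  the two squared increments around \<open>w n\<close>. If \<open>D n\<close> is small, then \<open>w (n + 1)\<close> is an approximate zero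
  of \<open>S + T\<close>, and comparing it with the Tikhonov approximants of \<open>p\<close> by monotonicity makes the last
  inner product almost nonpositive; otherwise the term \<open>h D n\<close> dominates because \<open>\<sigma> n \<rightarrow> 0\<close>.
  Everywhere-definedness of the resolvents (Minty) comes from minimizing the Fitzpatrick function of \<open>S\<close>
  plus half the squared norm, which is strongly convex.
\<close>

subsection \<open>Minty surjectivity\<close>

text \<open>A point monotonically related to the whole graph can be adjoined without losing
  monotonicity, so maximality already contains it. Conversely, each point of a monotone extension is
  related to the original graph.\<close>

lemma maximal_monotone_iff:
  "maximal_monotone S \<longleftrightarrow> monotone_operator S \<and>
     (\<forall>b v. (\<forall>a. \<forall>u\<in>S a. inner (u - v) (a - b) \<ge> 0) \<longrightarrow> v \<in> S b)"
proof
  assume S: "maximal_monotone S"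
  have "v \<in> S b" if *: "\<forall>a. \<forall>u\<in>S a. inner (u - v) (a - b) \<ge> 0" for b v
  proof (rule ccontr)
    assume v: "v \<notin> S b"
    define S' where "S' = S(b := insert v (S b))"
    have sym: "inner (v - u) (b - a) \<ge> 0" if "u \<in> S a" for a u
      using * that inner_minus_left[of "u - v" "a - b"]
        inner_minus_right[of "v - u" "a - b"] by simp
    have mono: "inner (u' - u) (a' - a) \<ge> 0" if "u' \<in> S a'" "u \<in> S a" for a a' u u'
      using S that unfolding monotone_operator_def maximal_monotone_def by blast
    have mem: "u \<in> S' a \<longleftrightarrow> u \<in> S a \<or> (a = b \<and> u = v)" for a u
      by (auto simp: S'_def)
    have "monotone_operator S'"
      unfolding monotone_operator_def
    proof (intro allI ballI)
      fix a a' u u' assume "u \<in> S' a" "u' \<in> S' a'"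
      then show "inner (u - u') (a - a') \<ge> 0"
        unfolding mem by (elim disjE conjE) (simp_all add: sym mono *)
    qed
    moreover have "Sigma UNIV S \<subset> Sigma UNIV S'"
      using v mem by blast
    ultimately show False using S unfolding maximal_monotone_def by blast
  qed
  then show "monotone_operator S \<and>
     (\<forall>b v. (\<forall>a. \<forall>u\<in>S a. inner (u - v) (a - b) \<ge> 0) \<longrightarrow> v \<in> S b)"
    using S by (auto simp: maximal_monotone_def)
next
  assume R: "monotone_operator S \<and>
     (\<forall>b v. (\<forall>a. \<forall>u\<in>S a. inner (u - v) (a - b) \<ge> 0) \<longrightarrow> v \<in> S b)"
  have "Sigma UNIV S' \<subseteq> Sigma UNIV S"
    if "monotone_operator S'" "Sigma UNIV S \<subseteq> Sigma UNIV S'" for S'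
  proof
    fix z assume z: "z \<in> Sigma UNIV S'"
    obtain b v where bv: "z = (b, v)" "v \<in> S' b" using z by auto
    have "\<forall>a. \<forall>u\<in>S a. inner (u - v) (a - b) \<ge> 0"
      using that bv unfolding monotone_operator_def by blast
    then show "z \<in> Sigma UNIV S" using R bv by blast
  qed
  then show "maximal_monotone S" using R unfolding maximal_monotone_def by blast
qed

lemma maximal_monotone_imp_monotone: "maximal_monotone S \<Longrightarrow> monotone_operator S"
  by (simp add: maximal_monotone_def)

lemma maximal_monotone_memI:
  assumes "maximal_monotone S" "\<And>a u. u \<in> S a \<Longrightarrow> inner (u - v) (a - b) \<ge> 0"
  shows "v \<in> S b"
  using assms maximal_monotone_iff by blast

lemma monotone_operatorD:
  assumes "monotone_operator S" "u \<in> S a" "v \<in> S b"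
  shows "inner (u - v) (a - b) \<ge> 0"
  using assms unfolding monotone_operator_def by blast

text \<open>Reduces the equation \<open>x + d *\<^sub>R u = y\<close> to finding \<open>x\<close>
  with \<open>- x\<close> in the value at \<open>x\<close> of the scaled and shifted
  operator.\<close>

lemma maximal_monotone_scale_translate:
  assumes S: "maximal_monotone S" and d: "d > 0"
  shows "maximal_monotone (\<lambda>x. {d *\<^sub>R u - y |u. u \<in> S x})"
  unfolding maximal_monotone_iff
proof (intro conjI allI impI)
  show "monotone_operator (\<lambda>x. {d *\<^sub>R u - y |u. u \<in> S x})"
    unfolding monotone_operator_def
  proof clarify
    fix a b u v assume "u \<in> S a" "v \<in> S b"
    then have "inner (u - v) (a - b) \<ge> 0"
      by (rule monotone_operatorD[OF maximal_monotone_imp_monotone[OF S]])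
    moreover have "d *\<^sub>R u - y - (d *\<^sub>R v - y) = d *\<^sub>R (u - v)" by (simp add: algebra_simps)
    ultimately show "inner (d *\<^sub>R u - y - (d *\<^sub>R v - y)) (a - b) \<ge> 0" using d by simp
  qed
next
  fix b v
  assume *: "\<forall>a. \<forall>u\<in>{d *\<^sub>R u - y |u. u \<in> S a}. 0 \<le> inner (u - v) (a - b)"
  have "(1/d) *\<^sub>R (v + y) \<in> S b"
  proof (rule maximal_monotone_memI[OF S])
    fix a u assume "u \<in> S a"
    then have "0 \<le> inner (d *\<^sub>R u - y - v) (a - b)" using * by blast
    moreover have "d *\<^sub>R u - y - v = d *\<^sub>R (u - (1/d) *\<^sub>R (v + y))"
      using d by (simp add: algebra_simps)
    ultimately have "0 \<le> d * inner (u - (1/d) *\<^sub>R (v + y)) (a - b)" by (metis inner_scaleR_left)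
    then show "0 \<le> inner (u - (1/d) *\<^sub>R (v + y)) (a - b)"
      using d by (simp add: zero_le_mult_iff)
  qed
  moreover have "v = d *\<^sub>R ((1/d) *\<^sub>R (v + y)) - y" using d by simp
  ultimately show "v \<in> {d *\<^sub>R u - y |u. u \<in> S b}" by blast
qed

lemma Cauchy_if_norm_diff_le:
  fixes x :: "nat \<Rightarrow> 'a::real_normed_vector"
  assumes le: "\<And>i j. (norm (x i - x j))\<^sup>2 \<le> g i + g j" and g: "g \<longlonglongrightarrow> (0::real)"
  shows "Cauchy x"
proof (rule metric_CauchyI)
  fix e :: real assume e: "e > 0"
  then have "eventually (\<lambda>n. g n < e\<^sup>2 / 2) sequentially"
    using g by (intro order_tendstoD) auto
  then obtain N where N: "\<And>n. n \<ge> N \<Longrightarrow> g n < e\<^sup>2 / 2"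
    unfolding eventually_sequentially by blast
  have "dist (x i) (x j) < e" if "i \<ge> N" "j \<ge> N" for i j
  proof -
    have "(norm (x i - x j))\<^sup>2 < e\<^sup>2" using le[of i j] N[OF that(1)] N[OF that(2)] by linarith
    then show ?thesis using e unfolding dist_norm by (simp add: power_less_imp_less_base)
  qed
  then show "\<exists>M. \<forall>m\<ge>M. \<forall>n\<ge>M. dist (x m) (x n) < e" by blast
qed

text \<open>Dividing by \<open>l\<close> and letting \<open>l\<close> tend to 0 leaves the linear
  coefficient; this extracts a first-order condition from a minimum along a segment.\<close>

lemma nonneg_if_quadratic_nonneg:
  assumes "\<And>l. 0 < l \<Longrightarrow> l \<le> 1 \<Longrightarrow> l * p + l\<^sup>2 * q \<ge> (0::real)"
  shows "p \<ge> 0"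
proof -
  have "((\<lambda>l. p + l * q) \<longlongrightarrow> p + 0 * q) (at_right 0)" by (intro tendsto_intros)
  moreover have "eventually (\<lambda>l. p + l * q \<ge> 0) (at_right 0)"
    unfolding eventually_at_right_field
  proof (intro exI[of _ 1] conjI allI impI)
    fix l :: real assume l: "0 < l" "l < 1"
    then have "l * (p + l * q) \<ge> 0" using assms[of l] by (simp add: algebra_simps power2_eq_square)
    then show "p + l * q \<ge> 0" using l by (simp add: zero_le_mult_iff)
  qed simp
  ultimately show ?thesis using tendsto_lowerbound[of "\<lambda>l. p + l * q" "p + 0 * q" "at_right 0" 0] by simp
qed

text \<open>The Fitzpatrick function may take the value \<open>\<infinity>\<close>, hence the epigraph.\<close>

definition fitzpatrick_epi :: "('a::real_inner \<Rightarrow> 'a set) \<Rightarrow> 'a \<Rightarrow> 'a \<Rightarrow> real \<Rightarrow> bool" where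
  "fitzpatrick_epi S x v t \<longleftrightarrow> (\<forall>a. \<forall>u\<in>S a. inner x u + inner a v - inner a u \<le> t)"

text \<open>If \<open>t\<close> were below the pairing, \<open>(x, v)\<close> would be strictly
  related to every graph point; maximality would put it in the graph, where it is not strictly
  related to itself.\<close>

lemma fitzpatrick_epi_ge:
  assumes S: "maximal_monotone S" and t: "fitzpatrick_epi S x v t"
  shows "inner x v \<le> t"
proof (rule ccontr)
  assume lt: "\<not> inner x v \<le> t"
  have pos: "inner (u - v) (a - x) > 0" if "u \<in> S a" for a u
    using t that lt unfolding fitzpatrick_epi_def
    by (force simp: inner_diff_left inner_diff_right inner_commute)
  then have "v \<in> S x" by (intro maximal_monotone_memI[OF S]) (simp add: less_imp_le)
  from pos[OF this] show False by simp
qed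

lemma fitzpatrick_epi_graph:
  assumes S: "monotone_operator S" and "v \<in> S x"
  shows "fitzpatrick_epi S x v (inner x v)"
  unfolding fitzpatrick_epi_def
proof (intro allI ballI)
  fix a u assume "u \<in> S a"
  from monotone_operatorD[OF S this assms(2)]
  show "inner x u + inner a v - inner a u \<le> inner x v"
    by (simp add: inner_diff_left inner_diff_right inner_commute)
qed

lemma fitzpatrick_epi_convex:
  assumes "fitzpatrick_epi S x v t" "fitzpatrick_epi S y u s" "0 \<le> l" "l \<le> 1"
  shows "fitzpatrick_epi S (x + l *\<^sub>R (y - x)) (v + l *\<^sub>R (u - v)) (t + l * (s - t))"
  unfolding fitzpatrick_epi_def
proof (intro allI ballI)
  fix a c assume c: "c \<in> S a"
  have "(1 - l) * (inner x c + inner a v - inner a c) \<le> (1 - l) * t"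
    using assms c unfolding fitzpatrick_epi_def by (intro mult_left_mono) auto
  moreover have "l * (inner y c + inner a u - inner a c) \<le> l * s"
    using assms c unfolding fitzpatrick_epi_def by (intro mult_left_mono) auto
  ultimately show "inner (x + l *\<^sub>R (y - x)) c + inner a (v + l *\<^sub>R (u - v)) - inner a c \<le> t + l * (s - t)"
    by (simp add: inner_add_left inner_diff_left inner_add_right inner_diff_right algebra_simps)
qed

lemma norm_sq_add_scaleR_diff:
  fixes x y :: "'a::real_inner"
  shows "(norm (x + l *\<^sub>R (y - x)))\<^sup>2 = (norm x)\<^sup>2 + 2 * l * inner x (y - x) + l\<^sup>2 * (norm (y - x))\<^sup>2"
  unfolding power2_norm_eq_inner
  by (simp add: inner_add_left inner_add_right inner_commute power2_eq_square algebra_simps)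

text \<open>The squared norms make the functional strongly convex, so a minimizing sequence is
  Cauchy; its limit stays in the epigraph, which is cut out by continuous inequalities.\<close>

lemma fitzpatrick_minimizer:
  fixes S :: "'a::{real_inner, complete_space} \<Rightarrow> 'a set"
  assumes S: "maximal_monotone S"
  obtains x v t where "fitzpatrick_epi S x v t"
    "\<And>y u s. fitzpatrick_epi S y u s \<Longrightarrow>
       t + ((norm x)\<^sup>2 + (norm v)\<^sup>2) / 2 \<le> s + ((norm y)\<^sup>2 + (norm u)\<^sup>2) / 2"
proof -
  define \<phi> where "\<phi> = (\<lambda>(x::'a) (v::'a) t. t + ((norm x)\<^sup>2 + (norm v)\<^sup>2) / 2)"
  define A where "A = {\<phi> x v t |x v t. fitzpatrick_epi S x v t}"
  define m where "m = Inf A"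
  have "0 \<le> \<phi> x v t" if "fitzpatrick_epi S x v t" for x v t
  proof -
    have "0 \<le> (norm (x + v))\<^sup>2" by simp
    also have "\<dots> = (norm x)\<^sup>2 + (norm v)\<^sup>2 + 2 * inner x v"
      by (simp add: power2_norm_eq_inner inner_add_left inner_add_right inner_commute)
    finally show ?thesis using fitzpatrick_epi_ge[OF S that] unfolding \<phi>_def by argo
  qed
  then have bdd: "bdd_below A" unfolding A_def by (intro bdd_belowI[of _ 0]) auto
  have "\<exists>a u. u \<in> S a"
  proof (rule ccontr)
    assume "\<nexists>a u. u \<in> S a"
    then have "0 \<in> S 0" by (intro maximal_monotone_memI[OF S]) auto
    then show False using \<open>\<nexists>a u. u \<in> S a\<close> by blast
  qed
  then obtain a u where "u \<in> S a" by blast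
  then have "fitzpatrick_epi S a u (inner a u)"
    by (rule fitzpatrick_epi_graph[OF maximal_monotone_imp_monotone[OF S]])
  then have ne: "A \<noteq> {}" unfolding A_def by blast
  have m_le: "m \<le> \<phi> x v t" if "fitzpatrick_epi S x v t" for x v t
    unfolding m_def by (rule cInf_lower[OF _ bdd]) (use that A_def in blast)
  define g where "g = (\<lambda>n. 1 / real (Suc n))"
  have g: "g \<longlonglongrightarrow> 0" using LIMSEQ_inverse_real_of_nat by (simp add: g_def field_simps)
  then have g0: "(\<lambda>n. 4 * g n) \<longlonglongrightarrow> 0" by (intro tendsto_mult_right_zero)
  have "\<exists>x v t. fitzpatrick_epi S x v t \<and> \<phi> x v t < m + g n" for n
  proof -
    have "\<exists>a\<in>A. a < m + g n"
      using cInf_lessD[OF ne, of "m + g n"] by (simp add: m_def g_def)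
    then show ?thesis unfolding A_def by blast
  qed
  then obtain x v t where epi: "\<And>n. fitzpatrick_epi S (x n) (v n) (t n)"
    and less: "\<And>n. \<phi> (x n) (v n) (t n) < m + g n" by metis
  have diff: "(norm (x i - x j))\<^sup>2 + (norm (v i - v j))\<^sup>2 \<le> 4 * g i + 4 * g j" for i j
  proof -
    \<comment> \<open>Parallelogram law at the midpoint: the midpoint value is at least
      \<open>m\<close>, so the two gaps to \<open>m\<close> bound the squared distances.\<close>
    have par: "(norm (y + (1/2) *\<^sub>R (z - y)))\<^sup>2 = ((norm y)\<^sup>2 + (norm z)\<^sup>2) / 2 - (norm (y - z))\<^sup>2 / 4"
      for y z :: 'a
      by (simp add: power2_norm_eq_inner inner_add_left inner_add_right inner_diff_left
          inner_diff_right inner_commute field_simps)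
    from m_le[OF fitzpatrick_epi_convex[OF epi[of i] epi[of j], of "1/2"]]
    have "8 * m \<le> 4 * (\<phi> (x i) (v i) (t i) + \<phi> (x j) (v j) (t j))
        - ((norm (x i - x j))\<^sup>2 + (norm (v i - v j))\<^sup>2)"
      unfolding \<phi>_def par by (simp add: field_simps)
    then show ?thesis using less[of i] less[of j] by argo
  qed
  have "Cauchy x"
    by (rule Cauchy_if_norm_diff_le[OF _ g0]) (use diff zero_le_power2 in \<open>meson le_add_same_cancel1 order_trans\<close>)
  then obtain x' where x': "x \<longlonglongrightarrow> x'" using Cauchy_convergent convergent_def by blast
  have "Cauchy v"
    by (rule Cauchy_if_norm_diff_le[OF _ g0]) (use diff zero_le_power2 in \<open>meson le_add_same_cancel2 order_trans\<close>)
  then obtain v' where v': "v \<longlonglongrightarrow> v'" using Cauchy_convergent convergent_def by blast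
  \<comment> \<open>Convergence of \<open>t\<close> is read off indirectly: the full functional
    tends to \<open>m\<close> and the norm terms converge, which leaves this value.\<close>
  define t' where "t' = m - ((norm x')\<^sup>2 + (norm v')\<^sup>2) / 2"
  have "(\<lambda>n. \<phi> (x n) (v n) (t n)) \<longlonglongrightarrow> m"
  proof (rule tendsto_sandwich)
    show "\<forall>\<^sub>F n in sequentially. m \<le> \<phi> (x n) (v n) (t n)"
      using m_le epi by (intro always_eventually) blast
    show "\<forall>\<^sub>F n in sequentially. \<phi> (x n) (v n) (t n) \<le> m + g n"
      using less by (intro always_eventually allI less_imp_le)
    show "(\<lambda>n. m + g n) \<longlonglongrightarrow> m"
      using tendsto_add[OF tendsto_const[of m] g] by simp
  qed simp
  then have "(\<lambda>n. \<phi> (x n) (v n) (t n) - ((norm (x n))\<^sup>2 + (norm (v n))\<^sup>2) / 2) \<longlonglongrightarrow> t'"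
    unfolding t'_def by (intro tendsto_intros x' v') auto
  then have t': "t \<longlonglongrightarrow> t'" by (simp add: \<phi>_def)
  have "fitzpatrick_epi S x' v' t'"
    unfolding fitzpatrick_epi_def
  proof (intro allI ballI)
    fix a u assume "u \<in> S a"
    then show "inner x' u + inner a v' - inner a u \<le> t'"
      using epi unfolding fitzpatrick_epi_def
      by (intro tendsto_le[OF _ t', of "\<lambda>n. inner (x n) u + inner a (v n) - inner a u"])
        (auto intro!: tendsto_intros x' v')
  qed
  moreover have "t' + ((norm x')\<^sup>2 + (norm v')\<^sup>2) / 2 \<le> s + ((norm y)\<^sup>2 + (norm u)\<^sup>2) / 2"
    if "fitzpatrick_epi S y u s" for y u s
    using m_le[OF that] unfolding t'_def \<phi>_def by argo
  ultimately show thesis using that by blast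
qed

text \<open>First-order optimality of the minimizer \<open>(x, v, t)\<close> says that \<open>(-v, -x)\<close> is monotonically
  related to the graph with the surplus \<open>norm (x + v)\<^sup>2\<close>, so it lies in the graph and \<open>v = -x\<close>.\<close>

lemma minty_zero:
  fixes S :: "'a::{real_inner, complete_space} \<Rightarrow> 'a set"
  assumes S: "maximal_monotone S"
  shows "\<exists>x. - x \<in> S x"
proof -
  obtain x v t where epi: "fitzpatrick_epi S x v t"
    and min: "\<And>y u s. fitzpatrick_epi S y u s \<Longrightarrow>
       t + ((norm x)\<^sup>2 + (norm v)\<^sup>2) / 2 \<le> s + ((norm y)\<^sup>2 + (norm u)\<^sup>2) / 2"
    using fitzpatrick_minimizer[OF S] by metis
  have key: "inner (c - (- x)) (b - (- v)) \<ge> (norm (x + v))\<^sup>2" if c: "c \<in> S b" for b c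
  proof -
    have bc: "fitzpatrick_epi S b c (inner b c)"
      by (rule fitzpatrick_epi_graph[OF maximal_monotone_imp_monotone[OF S] c])
    \<comment> \<open>The segment runs from the minimizer to the epigraph point over
      \<open>(b, c)\<close>; \<open>q\<close> collects the quadratic part of the norm terms.
      Replacing \<open>t\<close> by the smaller \<open>inner x v\<close> afterwards completes the
      square.\<close>
    have "inner b c - t + inner x (b - x) + inner v (c - v) \<ge> 0"
    proof (rule nonneg_if_quadratic_nonneg[where q = "((norm (b - x))\<^sup>2 + (norm (c - v))\<^sup>2) / 2"])
      fix l :: real assume "0 < l" "l \<le> 1"
      with min[OF fitzpatrick_epi_convex[OF epi bc, of l]]
      show "0 \<le> l * (inner b c - t + inner x (b - x) + inner v (c - v))
          + l\<^sup>2 * (((norm (b - x))\<^sup>2 + (norm (c - v))\<^sup>2) / 2)"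
        unfolding norm_sq_add_scaleR_diff by (simp add: algebra_simps add_divide_distrib diff_divide_distrib)
    qed
    moreover have "inner x v \<le> t" using fitzpatrick_epi_ge[OF S epi] .
    ultimately show ?thesis
      by (simp add: power2_norm_eq_inner inner_add_left inner_add_right inner_diff_left
          inner_diff_right inner_commute algebra_simps)
  qed
  have "- x \<in> S (- v)"
    by (rule maximal_monotone_memI[OF S]) (use key zero_le_power2 order_trans in blast)
  moreover from key[OF this] have "v = - x" by (simp add: eq_neg_iff_add_eq_0 add.commute)
  ultimately show ?thesis by auto
qed

lemma minty:
  fixes S :: "'a::{real_inner, complete_space} \<Rightarrow> 'a set"
  assumes S: "maximal_monotone S" and d: "d > 0"
  shows "\<exists>x. \<exists>u\<in>S x. x + d *\<^sub>R u = y"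
proof -
  obtain x where "- x \<in> {d *\<^sub>R u - y |u. u \<in> S x}"
    using minty_zero[OF maximal_monotone_scale_translate[OF S d]] by blast
  then obtain u where "u \<in> S x" "- x = d *\<^sub>R u - y" by blast
  then show ?thesis
    by (metis add.commute diff_eq_eq minus_diff_eq neg_eq_iff_add_eq_0 uminus_add_conv_diff)
qed

subsection \<open>Resolvents and Tikhonov regularization\<close>

text \<open>Monotonicity bounds the squared distance by an inner product, and Cauchy-Schwarz cancels
  one factor. This yields both uniqueness and nonexpansiveness of resolvent values.\<close>

lemma norm_diff_le_shifted_diff:
  assumes S: "monotone_operator S" and d: "d > 0"
    and "u \<in> S x" "v \<in> S y"
  shows "norm (x - y) \<le> norm ((x + d *\<^sub>R u) - (y + d *\<^sub>R v))"
proof -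
  have "0 \<le> d * inner (u - v) (x - y)" using monotone_operatorD[OF S assms(3,4)] d by simp
  then have "(norm (x - y))\<^sup>2 \<le> inner ((x + d *\<^sub>R u) - (y + d *\<^sub>R v)) (x - y)"
    by (simp add: power2_norm_eq_inner inner_add_left inner_diff_left algebra_simps)
  also have "\<dots> \<le> norm ((x + d *\<^sub>R u) - (y + d *\<^sub>R v)) * norm (x - y)" by (rule norm_cauchy_schwarz)
  finally show ?thesis by (cases "norm (x - y) = 0") (auto simp: power2_eq_square)
qed

text \<open>Turns \<open>the_elem\<close> into a genuine value: existence is \<open>minty\<close>,
  uniqueness is \<open>norm_diff_le_shifted_diff\<close>.\<close>

lemma resolvent_mem:
  fixes S :: "'a::{real_inner, complete_space} \<Rightarrow> 'a set"
  assumes S: "maximal_monotone S" and d: "d > 0"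
  obtains u where "u \<in> S (resolvent S d y)" "resolvent S d y + d *\<^sub>R u = y"
proof -
  obtain x u where xu: "u \<in> S x" "x + d *\<^sub>R u = y" using minty[OF assms] by blast
  have mono: "monotone_operator S" by (rule maximal_monotone_imp_monotone[OF S])
  have "operator_inverse (operator_plus (operator_scale d S) id) y = {z. \<exists>v\<in>S z. z + d *\<^sub>R v = y}"
    by (auto simp: operator_inverse_def operator_plus_def operator_scale_def add.commute)
  also have "\<dots> = {x}"
  proof -
    have "z = x" if "v \<in> S z" "z + d *\<^sub>R v = y" for z v
      using norm_diff_le_shifted_diff[OF mono d that(1) xu(1)] that xu by simp
    then show ?thesis using xu by blast
  qed
  finally have "resolvent S d y = x" by (simp add: resolvent_def)
  then show thesis using that xu by blast
qed

lemma resolvent_nonexpansive: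
  fixes S :: "'a::{real_inner, complete_space} \<Rightarrow> 'a set"
  assumes S: "maximal_monotone S" and d: "d > 0"
  shows "norm (resolvent S d y - resolvent S d z) \<le> norm (y - z)"
proof -
  obtain u where u: "u \<in> S (resolvent S d y)" "resolvent S d y + d *\<^sub>R u = y"
    using resolvent_mem[OF assms] by blast
  obtain v where v: "v \<in> S (resolvent S d z)" "resolvent S d z + d *\<^sub>R v = z"
    using resolvent_mem[OF assms] by blast
  have mono: "monotone_operator S" by (rule maximal_monotone_imp_monotone[OF S])
  show ?thesis using norm_diff_le_shifted_diff[OF mono d u(1) v(1)] u v by simp
qed

text \<open>The regularizer makes the single-valued part \<open>B\<close> strongly monotone with
  modulus \<open>t\<close> and Lipschitz with constant \<open>L + t\<close>. The forward-backward
  map \<open>G\<close> is then a contraction, and its fixed point satisfies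
  \<open>- B x \<in> S x\<close>.\<close>

lemma regularized_inclusion_solvable:
  fixes S :: "'a::{real_inner, complete_space} \<Rightarrow> 'a set"
  assumes S: "maximal_monotone S" and T: "monotone_point_map T"
    and L: "L-lipschitz_on UNIV T" and t: "t > 0"
  shows "\<exists>x. t *\<^sub>R (u - x) - T x \<in> S x"
proof -
  have L0: "L \<ge> 0" using L lipschitz_on_nonneg by blast
  \<comment> \<open>This \<open>d\<close> minimizes
    \<open>1 - 2 * d * t + d\<^sup>2 * (L + t)\<^sup>2\<close>, which bounds the squared contraction
    factor; \<open>q\<^sup>2\<close> below is the minimum.\<close>
  define d where "d = t / (L + t)\<^sup>2"
  have d: "d > 0" using t L0 by (simp add: d_def)
  define q where "q = sqrt (1 - t\<^sup>2 / (L + t)\<^sup>2)"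
  have "t\<^sup>2 / (L + t)\<^sup>2 \<le> 1" using t L0 by (simp add: power_mono)
  then have q: "0 \<le> q" "q\<^sup>2 = 1 - t\<^sup>2 / (L + t)\<^sup>2" by (simp_all add: q_def)
  have "q < 1" using t L0 by (simp add: q_def)
  define B where "B = (\<lambda>x. T x + t *\<^sub>R (x - u))"
  define G where "G = (\<lambda>x. resolvent S d (x - d *\<^sub>R B x))"
  have contr: "dist (G x) (G y) \<le> q * dist x y" for x y
  proof -
    let ?n = "norm (x - y)"
    have Bd: "B x - B y = (T x - T y) + t *\<^sub>R (x - y)" by (simp add: B_def algebra_simps)
    have "norm (T x - T y) \<le> L * ?n" using lipschitz_onD[OF L] by (simp add: dist_norm)
    moreover have "norm (t *\<^sub>R (x - y)) = t * ?n" using t by simp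
    ultimately have "norm (B x - B y) \<le> (L + t) * ?n"
      using norm_triangle_ineq[of "T x - T y" "t *\<^sub>R (x - y)"] unfolding Bd distrib_right
      by linarith
    then have BL: "(norm (B x - B y))\<^sup>2 \<le> (L + t)\<^sup>2 * ?n\<^sup>2"
      using power_mono[of "norm (B x - B y)" "(L + t) * ?n" 2] by (simp add: power_mult_distrib)
    have Bm: "inner (B x - B y) (x - y) \<ge> t * ?n\<^sup>2"
      using T unfolding Bd monotone_point_map_def
      by (simp add: inner_add_left power2_norm_eq_inner)
    have "(norm ((x - y) - d *\<^sub>R (B x - B y)))\<^sup>2
        = ?n\<^sup>2 - 2 * d * inner (B x - B y) (x - y) + d\<^sup>2 * (norm (B x - B y))\<^sup>2"
      unfolding power2_norm_eq_inner
      by (simp add: inner_diff_left inner_diff_right inner_commute power2_eq_square algebra_simps)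
    also have "\<dots> \<le> ?n\<^sup>2 - 2 * d * (t * ?n\<^sup>2) + d\<^sup>2 * ((L + t)\<^sup>2 * ?n\<^sup>2)"
      using d by (intro add_mono diff_mono mult_left_mono Bm BL) auto
    also have "\<dots> = (q * ?n)\<^sup>2"
    proof -
      have "d\<^sup>2 * (L + t)\<^sup>2 = d * t" using t L0 by (simp add: d_def power2_eq_square)
      moreover have "q\<^sup>2 = 1 - d * t" unfolding q by (simp add: d_def power2_eq_square)
      ultimately show ?thesis
        by (simp add: power_mult_distrib mult.assoc[symmetric] left_diff_distrib)
    qed
    finally have "norm ((x - y) - d *\<^sub>R (B x - B y)) \<le> q * ?n"
      by (rule power2_le_imp_le) (use q in simp)
    moreover have "norm (G x - G y) \<le> norm ((x - d *\<^sub>R B x) - (y - d *\<^sub>R B y))"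
      unfolding G_def by (rule resolvent_nonexpansive[OF S d])
    moreover have "(x - d *\<^sub>R B x) - (y - d *\<^sub>R B y) = (x - y) - d *\<^sub>R (B x - B y)"
      by (simp add: algebra_simps)
    ultimately show ?thesis by (simp add: dist_norm)
  qed
  obtain x where x: "G x = x"
    using banach_fix_type[of q G] q(1) \<open>q < 1\<close> contr by blast
  obtain v where v: "v \<in> S (G x)" "G x + d *\<^sub>R v = x - d *\<^sub>R B x"
    using resolvent_mem[OF S d] unfolding G_def by blast
  then have "d *\<^sub>R v = d *\<^sub>R (- B x)" using x by simp
  then have "v = - B x" using d by (simp only: scaleR_cancel_left) simp
  then have "v = t *\<^sub>R (u - x) - T x" by (simp add: B_def algebra_simps)
  then show ?thesis using v x by metis
qed

lemma mem_zeros_iff: "x \<in> operator_inverse (operator_plus S T) 0 \<longleftrightarrow> - T x \<in> S x"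
proof -
  have "0 = u + T x \<longleftrightarrow> u = - T x" for u by (metis eq_neg_iff_add_eq_0)
  then show ?thesis by (simp add: operator_inverse_def operator_plus_def)
qed

text \<open>Tikhonov regularization reaches the projection onto the zero set in norm, which replaces
  weak compactness everywhere below.\<close>

lemma tikhonov:
  fixes S :: "'a::{real_inner, complete_space} \<Rightarrow> 'a set"
  assumes S: "maximal_monotone S" and T: "monotone_point_map T"
    and L: "L-lipschitz_on UNIV T"
    and C: "C = operator_inverse (operator_plus S T) 0" "C \<noteq> {}"
  obtains x p where "\<And>k. (1 / real (Suc k)) *\<^sub>R (u - x k) - T (x k) \<in> S (x k)"
    "x \<longlonglongrightarrow> p" "p \<in> C" "\<And>z. z \<in> C \<Longrightarrow> inner (u - p) (z - p) \<le> 0"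
proof -
  define t where "t = (\<lambda>k. 1 / real (Suc k))"
  have tpos: "t k > 0" for k by (simp add: t_def)
  have mono: "monotone_operator S" by (rule maximal_monotone_imp_monotone[OF S])
  have "\<forall>k. \<exists>x. t k *\<^sub>R (u - x) - T x \<in> S x"
    using regularized_inclusion_solvable[OF S T L tpos] by blast
  then obtain x where x: "\<And>k. t k *\<^sub>R (u - x k) - T (x k) \<in> S (x k)" by metis
  define y where "y = (\<lambda>k. x k - u)"
  \<comment> \<open>When the monotonicity inequalities of \<open>S\<close> and \<open>T\<close>
    between \<open>x k\<close> and the zero \<open>z\<close> are added, the operator values cancel
    and only the regularizer remains.\<close>
  have VI: "inner (u - x k) (z - x k) \<le> 0" if "z \<in> C" for k z
  proof -
    have "inner ((t k *\<^sub>R (u - x k) - T (x k)) - (- T z)) (x k - z) \<ge> 0"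
      using that C by (intro monotone_operatorD[OF mono x]) (simp add: mem_zeros_iff)
    moreover have "inner (T (x k) - T z) (x k - z) \<ge> 0"
      using T monotone_point_map_def by blast
    ultimately have "t k * inner (u - x k) (x k - z) \<ge> 0"
      by (simp add: inner_diff_left inner_diff_right algebra_simps)
    then have "inner (u - x k) (x k - z) \<ge> 0" using tpos[of k] by (simp add: zero_le_mult_iff)
    then show ?thesis by (simp add: inner_diff_right)
  qed
  \<comment> \<open>Comparing two approximants in the same way shows that the squared norms grow by
    at least the squared distance. Once the norms are bounded, through \<open>VI\<close> at one
    fixed zero, this makes \<open>y\<close> Cauchy.\<close>
  have step: "(norm (y j - y i))\<^sup>2 \<le> (norm (y j))\<^sup>2 - (norm (y i))\<^sup>2" if "i < j" for i j
  proof -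
    have lt: "t j < t i" using that by (simp add: t_def field_simps)
    have "inner ((t i *\<^sub>R (u - x i) - T (x i)) - (t j *\<^sub>R (u - x j) - T (x j))) (x i - x j) \<ge> 0"
      by (intro monotone_operatorD[OF mono x x])
    moreover have "inner (T (x i) - T (x j)) (x i - x j) \<ge> 0"
      using T monotone_point_map_def by blast
    ultimately have "inner (t j *\<^sub>R y j - t i *\<^sub>R y i) (y i - y j) \<ge> 0"
      unfolding y_def by (simp add: inner_diff_left inner_diff_right algebra_simps)
    moreover have "inner (t j *\<^sub>R y j - t i *\<^sub>R y i) (y i - y j)
       = - t j * (norm (y j - y i))\<^sup>2 - (t i - t j) * inner (y i) (y i - y j)"
      by (simp add: power2_norm_eq_inner inner_diff_left inner_diff_right inner_commute algebra_simps)
    moreover have "t j * (norm (y j - y i))\<^sup>2 \<ge> 0" using tpos[of j] by simp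
    ultimately have "(t i - t j) * inner (y i) (y i - y j) \<le> 0" by linarith
    then have "inner (y i) (y i - y j) \<le> 0" using lt by (simp add: mult_le_0_iff)
    then show ?thesis
      by (simp add: power2_norm_eq_inner inner_diff_left inner_diff_right inner_commute algebra_simps)
  qed
  have inc: "incseq (\<lambda>k. (norm (y k))\<^sup>2)"
    unfolding incseq_Suc_iff
  proof
    fix k
    show "(norm (y k))\<^sup>2 \<le> (norm (y (Suc k)))\<^sup>2"
      using step[OF lessI[of k]] zero_le_power2[of "norm (y (Suc k) - y k)"] by linarith
  qed
  obtain z where z: "z \<in> C" using C by blast
  have "(norm (y k))\<^sup>2 \<le> (norm (z - u))\<^sup>2" for k
  proof -
    have "(norm (y k))\<^sup>2 \<le> inner (y k) (z - u)"
      using VI[OF z, of k] unfolding y_def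
      by (simp add: power2_norm_eq_inner inner_diff_left inner_diff_right inner_commute algebra_simps)
    also have "\<dots> \<le> norm (y k) * norm (z - u)" by (rule norm_cauchy_schwarz)
    finally have "norm (y k) \<le> norm (z - u)"
      by (cases "norm (y k) = 0") (auto simp: power2_eq_square)
    then show ?thesis by (simp add: power_mono)
  qed
  then obtain R where R: "(\<lambda>k. (norm (y k))\<^sup>2) \<longlonglongrightarrow> R" "\<And>k. (norm (y k))\<^sup>2 \<le> R"
    using incseq_convergent[OF inc] by blast
  have "Cauchy y"
  proof (rule Cauchy_if_norm_diff_le)
    show "(\<lambda>k. R - (norm (y k))\<^sup>2) \<longlonglongrightarrow> 0" using tendsto_diff[OF tendsto_const R(1), of R] by simp
    show "(norm (y i - y j))\<^sup>2 \<le> (R - (norm (y i))\<^sup>2) + (R - (norm (y j))\<^sup>2)" for i j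
    proof (cases i j rule: linorder_cases)
      case less
      then show ?thesis using step[OF less] R(2)[of j] by (simp add: norm_minus_commute)
    next
      case greater
      then show ?thesis using step[OF greater] R(2)[of i] by simp
    qed (use R(2)[of j] in simp)
  qed
  then obtain y' where y': "y \<longlonglongrightarrow> y'" using Cauchy_convergent convergent_def by blast
  define p where "p = y' + u"
  have xp: "x \<longlonglongrightarrow> p"
    using tendsto_add[OF y' tendsto_const[of u]] by (simp add: y_def p_def)
  have "isCont T p"
    using lipschitz_on_continuous_on[OF L] by (simp add: continuous_on_eq_continuous_at)
  then have Tx: "(\<lambda>k. T (x k)) \<longlonglongrightarrow> T p" using xp isCont_tendsto_compose by blast
  have t0: "t \<longlonglongrightarrow> 0" using LIMSEQ_inverse_real_of_nat by (simp add: t_def field_simps)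
  \<comment> \<open>Monotonicity against any fixed graph point passes to the strong limit, and
    maximality then gives membership.\<close>
  have "- T p \<in> S p"
  proof (rule maximal_monotone_memI[OF S])
    fix a v assume "v \<in> S a"
    then have "inner (v - (t k *\<^sub>R (u - x k) - T (x k))) (a - x k) \<ge> 0" for k
      by (intro monotone_operatorD[OF mono _ x])
    moreover have lim: "(\<lambda>k. inner (v - (t k *\<^sub>R (u - x k) - T (x k))) (a - x k))
        \<longlonglongrightarrow> inner (v - (0 *\<^sub>R (u - p) - T p)) (a - p)"
      by (intro tendsto_intros t0 xp Tx)
    ultimately show "inner (v - (- T p)) (a - p) \<ge> 0"
      using LIMSEQ_le_const[OF lim, of 0] by simp
  qed
  then have "p \<in> C" using C mem_zeros_iff by blast
  moreover have "inner (u - p) (z - p) \<le> 0" if "z \<in> C" for z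
  proof (rule LIMSEQ_le_const2)
    show "(\<lambda>k. inner (u - x k) (z - x k)) \<longlonglongrightarrow> inner (u - p) (z - p)"
      by (intro tendsto_intros xp)
  qed (use VI[OF that] in blast)
  ultimately show thesis using that x xp unfolding t_def by blast
qed

section \<open>Projections through variational inequalities\<close>

text \<open>Expanding the square gives a Pythagorean inequality whose extra term
  \<open>(dist y p)\<^sup>2\<close> yields minimality and uniqueness at once.\<close>

lemma metric_projection_eqI:
  assumes "p \<in> C" "\<And>z. z \<in> C \<Longrightarrow> inner (u - p) (z - p) \<le> 0"
  shows "metric_projection C u = p"
proof -
  have le: "(dist u p)\<^sup>2 + (dist y p)\<^sup>2 \<le> (dist u y)\<^sup>2" if "y \<in> C" for y
  proof -
    have "(dist u y)\<^sup>2 = (dist u p)\<^sup>2 + (dist y p)\<^sup>2 - 2 * inner (u - p) (y - p)"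
      unfolding dist_norm power2_norm_eq_inner
      by (simp add: inner_diff_left inner_diff_right inner_commute)
    then show ?thesis using assms(2)[OF that] by linarith
  qed
  show ?thesis
    unfolding metric_projection_def
  proof (rule the_equality)
    have "dist u p \<le> dist u y" if "y \<in> C" for y
    proof (rule power2_le_imp_le)
      show "(dist u p)\<^sup>2 \<le> (dist u y)\<^sup>2"
        using le[OF that] zero_le_power2[of "dist y p"] by linarith
    qed simp
    then show "p \<in> C \<and> (\<forall>y\<in>C. dist u p \<le> dist u y)" using assms by blast
    fix q assume q: "q \<in> C \<and> (\<forall>y\<in>C. dist u q \<le> dist u y)"
    then have "(dist u q)\<^sup>2 \<le> (dist u p)\<^sup>2" using assms(1) by (intro power_mono) auto
    then have "(dist q p)\<^sup>2 \<le> 0" using le[of q] q by linarith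
    then show "q = p" by simp
  qed
qed

text \<open>Each variational inequality is tested at the other point. Thus projecting after
  \<open>U\<close> preserves its contraction constant.\<close>

lemma variational_nonexpansive:
  assumes "p \<in> C" "\<And>z. z \<in> C \<Longrightarrow> inner (u - p) (z - p) \<le> 0"
    and "q \<in> C" "\<And>z. z \<in> C \<Longrightarrow> inner (v - q) (z - q) \<le> 0"
  shows "dist p q \<le> dist u v"
proof -
  have "(norm (p - q))\<^sup>2 \<le> inner (u - v) (p - q)"
  proof -
    have "inner (u - v) (p - q) = (norm (p - q))\<^sup>2 - inner (u - p) (q - p) - inner (v - q) (p - q)"
      unfolding power2_norm_eq_inner by (simp add: inner_diff_left inner_diff_right inner_commute)
    then show ?thesis using assms(2)[OF assms(3)] assms(4)[OF assms(1)] by linarith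
  qed
  also have "\<dots> \<le> norm (u - v) * norm (p - q)" by (rule norm_cauchy_schwarz)
  finally show ?thesis
    by (cases "norm (p - q) = 0") (auto simp: power2_eq_square dist_norm)
qed

subsection \<open>Lyapunov estimate and recursions\<close>

text \<open>Takes the place of a weak cluster point argument. One approximant \<open>x j\<close>
  close to \<open>p\<close> is fixed; monotonicity against it bounds
  \<open>inner (u - x j) (y - x j)\<close> by a multiple of the residual
  \<open>norm (v + T y)\<close>, and the return from \<open>x j\<close> to \<open>p\<close> costs at
  most \<open>\<eta> / 2\<close>.\<close>

lemma approximate_zero_variational:
  fixes S :: "'a::real_inner \<Rightarrow> 'a set"
  assumes S: "monotone_operator S" and T: "monotone_point_map T"
    and x: "\<And>k. (1 / real (Suc k)) *\<^sub>R (u - x k) - T (x k) \<in> S (x k)"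
    and xp: "x \<longlonglongrightarrow> p" and \<eta>: "\<eta> > 0" and R: "R \<ge> 0"
  shows "\<exists>\<zeta>>0. \<forall>y v. v \<in> S y \<longrightarrow> norm (y - p) \<le> R \<longrightarrow> norm (v + T y) \<le> \<zeta> \<longrightarrow> inner (u - p) (y - p) \<le> \<eta>"
proof -
  have "(\<lambda>k. norm (x k - p) * (R + norm (u - x k))) \<longlonglongrightarrow> norm (p - p) * (R + norm (u - p))"
    by (intro tendsto_intros xp)
  then have "eventually (\<lambda>k. norm (x k - p) * (R + norm (u - x k)) < \<eta> / 2) sequentially"
    using \<eta> by (intro order_tendstoD(2)) auto
  then obtain j where j: "norm (x j - p) * (R + norm (u - x j)) < \<eta> / 2"
    unfolding eventually_sequentially by blast
  \<comment> \<open>With \<open>j\<close> fixed, \<open>t\<close> is a positive constant. As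
    \<open>Q\<close> bounds \<open>norm (y - x j)\<close>, the threshold
    \<open>t * \<eta> / (2 * Q)\<close> on the residual contributes \<open>\<eta> / 2\<close> after
    division by \<open>t\<close>.\<close>
  define t where "t = 1 / real (Suc j)"
  have t: "t > 0" by (simp add: t_def)
  define Q where "Q = R + norm (x j - p) + 1"
  have Q: "Q > 0" unfolding Q_def using R norm_ge_zero[of "x j - p"] by linarith
  have "inner (u - p) (y - p) \<le> \<eta>"
    if v: "v \<in> S y" and y: "norm (y - p) \<le> R" and e: "norm (v + T y) \<le> t * \<eta> / (2 * Q)" for y v
  proof -
    have "inner (v - (t *\<^sub>R (u - x j) - T (x j))) (y - x j) \<ge> 0"
      unfolding t_def by (rule monotone_operatorD[OF S v x])
    moreover have "inner (T y - T (x j)) (y - x j) \<ge> 0"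
      using T unfolding monotone_point_map_def by blast
    ultimately have "t * inner (u - x j) (y - x j) \<le> inner (v + T y) (y - x j)"
      by (simp add: inner_diff_left inner_add_left algebra_simps)
    also have "\<dots> \<le> norm (v + T y) * norm (y - x j)" by (rule norm_cauchy_schwarz)
    also have "\<dots> \<le> t * \<eta> / (2 * Q) * Q"
    proof (rule mult_mono[OF e])
      have "norm (y - x j) \<le> norm (y - p) + norm (x j - p)"
        using norm_triangle_ineq4[of "y - p" "x j - p"] by simp
      then show "norm (y - x j) \<le> Q" using y unfolding Q_def by linarith
      show "0 \<le> t * \<eta> / (2 * Q)" using t \<eta> Q by simp
    qed simp
    also have "\<dots> = t * (\<eta> / 2)" using Q by simp
    finally have 1: "inner (u - x j) (y - x j) \<le> \<eta> / 2" using t by simp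
    have "inner (u - p) (y - p) - inner (u - x j) (y - x j)
        = inner (x j - p) (y - p) + inner (u - x j) (x j - p)"
      by (simp add: inner_diff_left inner_diff_right inner_commute)
    also have "\<dots> \<le> norm (x j - p) * norm (y - p) + norm (u - x j) * norm (x j - p)"
      by (intro add_mono norm_cauchy_schwarz)
    also have "\<dots> \<le> norm (x j - p) * R + norm (u - x j) * norm (x j - p)"
      using y by (intro add_mono mult_left_mono) auto
    also have "\<dots> = norm (x j - p) * (R + norm (u - x j))" by (simp add: algebra_simps)
    finally show ?thesis using 1 j by linarith
  qed
  then show ?thesis using t \<eta> Q by (intro exI[of _ "t * \<eta> / (2 * Q)"]) auto
qed

lemma two_inner_le:
  fixes a b :: "'a::real_inner"
  assumes "norm a \<le> k * n" "0 \<le> k"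
  shows "2 * inner a b \<le> k * (n\<^sup>2 + (norm b)\<^sup>2)"
proof -
  have "inner a b \<le> norm a * norm b" by (rule norm_cauchy_schwarz)
  also have "\<dots> \<le> k * n * norm b" using assms by (intro mult_right_mono) auto
  finally have "2 * inner a b \<le> k * (2 * n * norm b)" by (simp add: mult.assoc)
  also have "\<dots> \<le> k * (n\<^sup>2 + (norm b)\<^sup>2)"
    using assms(2) by (intro mult_left_mono sum_squares_bound)
  finally show ?thesis .
qed

text \<open>\<open>incl\<close> encodes monotonicity of \<open>S\<close> between \<open>x2\<close>
  and the zero \<open>p\<close>, scaled by \<open>d1\<close>. In the proof, \<open>f\<close> and
  \<open>g\<close> are the same cross term at consecutive iterations and telescope with factor
  \<open>\<theta>\<close>, which is why \<open>T1 - T0\<close> carries that weight. What remains is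
  \<open>h\<close>, paid for by squared increments, and \<open>v\<close>, controlled by the
  contraction.\<close>

lemma frb_lyapunov_step:
  fixes x0 x1 x2 p T0 T1 T2 Tp U1 Up :: "'a::real_inner"
  assumes incl: "inner (\<sigma> *\<^sub>R U1 + (1 - \<sigma>) *\<^sub>R x1 - x2 - d1 *\<^sub>R T1 - (d0 * \<theta>) *\<^sub>R (T1 - T0) + d1 *\<^sub>R Tp) (x2 - p) \<ge> 0"
    and T2: "inner (T2 - Tp) (x2 - p) \<ge> 0"
    and U: "norm (U1 - Up) \<le> \<kappa> * norm (x1 - p)"
    and A: "d0 * norm (T1 - T0) \<le> \<rho> * norm (x1 - x0)"
    and \<sigma>: "0 \<le> \<sigma>" and \<kappa>: "0 \<le> \<kappa>" and \<theta>: "\<theta> = 1 - \<sigma> * (1 - 2 * \<kappa>)" "0 \<le> \<theta>"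
    and d: "0 \<le> d0" "0 \<le> d1" and \<rho>: "0 \<le> \<rho>"
  shows "(norm (x2 - p))\<^sup>2 - 2 * d1 * inner (T2 - T1) (x2 - p)
      + (1 - \<sigma> - \<theta> * \<rho>) * (norm (x2 - x1))\<^sup>2 + \<sigma> * (1 - \<kappa>) * (norm (x2 - p))\<^sup>2
    \<le> \<theta> * ((norm (x1 - p))\<^sup>2 - 2 * d0 * inner (T1 - T0) (x1 - p) + \<rho> * (norm (x1 - x0))\<^sup>2)
      + 2 * \<sigma> * inner (Up - p) (x2 - p)"
proof -
  define E where "E = (norm (x2 - p))\<^sup>2"
  define a where "a = (norm (x1 - p))\<^sup>2"
  define D where "D = (norm (x2 - x1))\<^sup>2"
  define D' where "D' = (norm (x1 - x0))\<^sup>2"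
  define f where "f = d1 * inner (T2 - T1) (x2 - p)"
  define g where "g = d0 * inner (T1 - T0) (x1 - p)"
  define h where "h = d0 * inner (T1 - T0) (x2 - x1)"
  define v where "v = inner (U1 - Up) (x2 - p)"
  define b where "b = inner (Up - p) (x2 - p)"
  have v: "2 * v \<le> \<kappa> * (a + E)"
    unfolding v_def a_def E_def by (rule two_inner_le[OF U \<kappa>])
  have "norm (- (d0 *\<^sub>R (T1 - T0))) \<le> \<rho> * norm (x1 - x0)" using A d by simp
  from two_inner_le[OF this \<rho>, of "x2 - x1"] have h: "- (2 * h) \<le> \<rho> * (D' + D)"
    by (simp add: h_def D_def D'_def)
  \<comment> \<open>Regrouped to isolate \<open>T2 - Tp\<close>, discarded by monotonicity of
    \<open>T\<close>, and \<open>T2 - T1\<close>, which enters the next Lyapunov value.\<close>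
  have "\<sigma> *\<^sub>R U1 + (1 - \<sigma>) *\<^sub>R x1 - x2 - d1 *\<^sub>R T1 - (d0 * \<theta>) *\<^sub>R (T1 - T0) + d1 *\<^sub>R Tp
     = \<sigma> *\<^sub>R ((U1 - Up) + (Up - p) - (x2 - p)) + (1 - \<sigma>) *\<^sub>R (x1 - x2) + d1 *\<^sub>R (T2 - T1)
       - d1 *\<^sub>R (T2 - Tp) - \<theta> *\<^sub>R d0 *\<^sub>R (T1 - T0)"
    by (simp add: algebra_simps)
  then have "0 \<le> \<sigma> * (v + b - E) + (1 - \<sigma>) * inner (x1 - x2) (x2 - p) + f
      - d1 * inner (T2 - Tp) (x2 - p) - \<theta> * (d0 * inner (T1 - T0) (x2 - p))"
    using incl unfolding v_def b_def E_def f_def power2_norm_eq_inner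
    by (simp only: inner_add_left inner_diff_left inner_scaleR_left)
  moreover have "0 \<le> d1 * inner (T2 - Tp) (x2 - p)" using T2 d by simp
  moreover have "d0 * inner (T1 - T0) (x2 - p) = g + h"
    unfolding g_def h_def distrib_left[symmetric] inner_add_right[symmetric] by simp
  ultimately have main: "0 \<le> \<sigma> * (v + b - E) + (1 - \<sigma>) * inner (x1 - x2) (x2 - p) + f - \<theta> * (g + h)"
    by simp
  have "2 * inner (x1 - x2) (x2 - p) = a - D - E"
    unfolding a_def D_def E_def power2_norm_eq_inner
    by (simp add: inner_diff_left inner_diff_right inner_commute)
  then have "2 * ((1 - \<sigma>) * inner (x1 - x2) (x2 - p)) = (1 - \<sigma>) * (a - D - E)"
    by (simp add: mult.left_commute)
  with main have main: "0 \<le> 2 * (\<sigma> * (v + b - E)) + (1 - \<sigma>) * (a - D - E) + 2 * f - 2 * (\<theta> * (g + h))"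
    by linarith
  have "\<sigma> * (2 * v) \<le> \<sigma> * (\<kappa> * (a + E))" by (rule mult_left_mono[OF v \<sigma>])
  moreover have "\<theta> * (- (2 * h)) \<le> \<theta> * (\<rho> * (D' + D))" by (rule mult_left_mono[OF h \<theta>(2)])
  \<comment> \<open>The bound on \<open>v\<close> consumes only one of the two copies of
    \<open>\<sigma> * \<kappa> * a\<close>; the other is nonnegative slack.\<close>
  moreover have "\<theta> * a = a - \<sigma> * a + 2 * (\<sigma> * \<kappa> * a)" unfolding \<theta>(1) by (simp add: algebra_simps)
  moreover have "0 \<le> \<sigma> * \<kappa> * a" using \<sigma> \<kappa> by (simp add: a_def)
  ultimately have "E - 2 * f + (1 - \<sigma> - \<theta> * \<rho>) * D + \<sigma> * (1 - \<kappa>) * E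
     \<le> \<theta> * (a - 2 * g + \<rho> * D') + 2 * \<sigma> * b"
    using main by (simp add: algebra_simps)
  then show ?thesis unfolding E_def f_def D_def a_def g_def D'_def b_def by (simp only: mult.assoc)
qed

text \<open>Solving the update for \<open>d1 *\<^sub>R (v + T2)\<close> leaves four terms, each
  controlled by \<open>\<mu>\<close>. So small increments and a small \<open>\<sigma>\<close> make
  \<open>x2\<close> an approximate zero of the sum.\<close>

lemma frb_residual_bound:
  fixes x0 x1 x2 v T0 T1 T2 U1 :: "'a::real_inner"
  assumes upd: "x2 + d1 *\<^sub>R v = \<sigma> *\<^sub>R U1 + (1 - \<sigma>) *\<^sub>R x1 - d1 *\<^sub>R T1 - (d0 * \<theta>) *\<^sub>R (T1 - T0)"
    and m: "0 < m" "m \<le> d1" and d0: "0 \<le> d0" and \<rho>: "0 \<le> \<rho>" and L: "0 \<le> L"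
    and \<theta>: "0 \<le> \<theta>" "\<theta> \<le> 1" and \<sigma>: "0 \<le> \<sigma>" "\<sigma> \<le> \<mu>"
    and U: "norm (U1 - x1) \<le> K"
    and x: "norm (x2 - x1) \<le> \<mu>" "norm (x1 - x0) \<le> \<mu>"
    and A: "d0 * norm (T1 - T0) \<le> \<rho> * norm (x1 - x0)"
    and T: "norm (T2 - T1) \<le> L * norm (x2 - x1)"
  shows "norm (v + T2) \<le> ((K + 1 + \<rho>) / m + L) * \<mu>"
proof -
  have \<mu>: "0 \<le> \<mu>" using \<sigma> by linarith
  have K: "0 \<le> K" using U norm_ge_zero order_trans by blast
  have "d1 *\<^sub>R (v + T2)
      = \<sigma> *\<^sub>R (U1 - x1) + (x1 - x2) - (d0 * \<theta>) *\<^sub>R (T1 - T0) + d1 *\<^sub>R (T2 - T1)"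
    using upd by (simp add: algebra_simps eq_diff_eq add_eq_0_iff)
  then have "d1 * norm (v + T2)
      = norm (\<sigma> *\<^sub>R (U1 - x1) + (x1 - x2) - (d0 * \<theta>) *\<^sub>R (T1 - T0) + d1 *\<^sub>R (T2 - T1))"
    using m by (metis abs_of_pos less_le_trans norm_scaleR)
  also have "\<dots> \<le> norm (\<sigma> *\<^sub>R (U1 - x1)) + norm (x1 - x2) + norm ((d0 * \<theta>) *\<^sub>R (T1 - T0)) + norm (d1 *\<^sub>R (T2 - T1))"
    by (intro order_trans[OF norm_triangle_ineq] order_trans[OF norm_triangle_ineq4] add_mono order_refl norm_triangle_ineq)
  also have "\<dots> \<le> \<mu> * K + \<mu> + \<rho> * \<mu> + d1 * (L * \<mu>)"
  proof (intro add_mono)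
    show "norm (\<sigma> *\<^sub>R (U1 - x1)) \<le> \<mu> * K" using \<sigma> U K \<mu> by (simp add: mult_mono)
    show "norm (x1 - x2) \<le> \<mu>" using x(1) by (simp add: norm_minus_commute)
    have "\<theta> * (d0 * norm (T1 - T0)) \<le> 1 * (\<rho> * \<mu>)"
      using \<theta> d0 \<rho> \<mu> x(2) by (intro mult_mono order_trans[OF A] mult_left_mono) auto
    then show "norm ((d0 * \<theta>) *\<^sub>R (T1 - T0)) \<le> \<rho> * \<mu>" using \<theta> d0 by (simp add: abs_mult ac_simps)
    have "norm (T2 - T1) \<le> L * \<mu>" using T mult_left_mono[OF x(1) L] by linarith
    then show "norm (d1 *\<^sub>R (T2 - T1)) \<le> d1 * (L * \<mu>)" using m by (simp add: mult_left_mono)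
  qed
  also have "\<dots> = (K + 1 + \<rho>) * \<mu> + d1 * (L * \<mu>)" by (simp add: algebra_simps)
  \<comment> \<open>As \<open>1 \<le> d1 / m\<close>, the factor \<open>d1\<close> can be pulled out
    of every term and cancelled.\<close>
  also have "\<dots> \<le> (d1 / m) * ((K + 1 + \<rho>) * \<mu>) + d1 * (L * \<mu>)"
  proof -
    have "1 * ((K + 1 + \<rho>) * \<mu>) \<le> (d1 / m) * ((K + 1 + \<rho>) * \<mu>)"
      using m K \<rho> \<mu> by (intro mult_right_mono) auto
    then show ?thesis by simp
  qed
  also have "\<dots> = d1 * (((K + 1 + \<rho>) / m + L) * \<mu>)" by (simp add: algebra_simps add_divide_distrib)
  finally show ?thesis using m by simp
qed

section \<open>Scalar recursions and step sizes\<close>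

text \<open>The right-hand side of the recursion is a convex combination of \<open>s n\<close> and
  \<open>K / \<gamma>\<close>.\<close>

lemma relaxed_recursion_bounded:
  fixes s \<sigma> :: "nat \<Rightarrow> real"
  assumes rec: "\<And>n. n \<ge> N \<Longrightarrow> s (Suc n) \<le> (1 - \<gamma> * \<sigma> n) * s n + \<sigma> n * K"
    and \<sigma>: "\<And>n. n \<ge> N \<Longrightarrow> 0 \<le> \<sigma> n \<and> \<gamma> * \<sigma> n \<le> 1" and \<gamma>: "\<gamma> > 0" and n: "n \<ge> N"
  shows "s n \<le> max (s N) (K / \<gamma>)"
  using n
proof (induction n rule: dec_induct)
  case (step n)
  let ?B = "max (s N) (K / \<gamma>)"
  have "s (Suc n) \<le> (1 - \<gamma> * \<sigma> n) * s n + \<gamma> * \<sigma> n * (K / \<gamma>)"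
    using rec[OF step(1)] \<gamma> by simp
  also have "\<dots> \<le> (1 - \<gamma> * \<sigma> n) * ?B + \<gamma> * \<sigma> n * ?B"
    using \<sigma>[OF step(1)] \<gamma> step.IH by (intro add_mono mult_left_mono) auto
  finally show ?case by (simp add: algebra_simps)
qed simp

text \<open>The excess over the equilibrium \<open>\<eta> / \<gamma>\<close> shrinks by factors
  \<open>1 - \<gamma> * \<sigma> n\<close>, each at most
  \<open>exp (- (\<gamma> * \<sigma> n))\<close>; divergence of the sum drives their product to
  0.\<close>

lemma relaxed_recursion_eventually_le:
  fixes s \<sigma> :: "nat \<Rightarrow> real"
  assumes rec: "eventually (\<lambda>n. s (Suc n) \<le> (1 - \<gamma> * \<sigma> n) * s n + \<sigma> n * \<eta>) sequentially"
    and \<sigma>: "eventually (\<lambda>n. 0 \<le> \<sigma> n \<and> \<gamma> * \<sigma> n \<le> 1) sequentially"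
    and \<gamma>: "\<gamma> > 0" and \<eta>: "\<eta> > 0"
    and div: "filterlim (\<lambda>n. \<Sum>k<n. \<sigma> k) at_top sequentially"
  shows "eventually (\<lambda>n. s n < 2 * \<eta> / \<gamma>) sequentially"
proof -
  obtain N where rec: "\<And>n. n \<ge> N \<Longrightarrow> s (Suc n) \<le> (1 - \<gamma> * \<sigma> n) * s n + \<sigma> n * \<eta>"
    and \<sigma>: "\<And>n. n \<ge> N \<Longrightarrow> 0 \<le> \<sigma> n \<and> \<gamma> * \<sigma> n \<le> 1"
    using eventually_conj[OF rec \<sigma>] unfolding eventually_sequentially by blast
  define V where "V = (\<lambda>n. \<Sum>k<n. \<sigma> k)"
  define q where "q = \<eta> / \<gamma>"
  \<comment> \<open>Truncation at 0 keeps the majorant nonnegative, so that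
    \<open>1 - \<gamma> * \<sigma> n\<close> may be replaced by the larger exponential.\<close>
  define M where "M = max 0 (s N - q)"
  have bound: "s n - q \<le> exp (- \<gamma> * (V n - V N)) * M" if "n \<ge> N" for n
    using that
  proof (induction n rule: dec_induct)
    case (step n)
    have \<eta>q: "\<eta> = \<gamma> * q" using \<gamma> by (simp add: q_def)
    have "s (Suc n) - q \<le> (1 - \<gamma> * \<sigma> n) * (s n - q)"
      using rec[OF step(1)] unfolding \<eta>q by (simp add: algebra_simps)
    also have "\<dots> \<le> (1 - \<gamma> * \<sigma> n) * (exp (- \<gamma> * (V n - V N)) * M)"
      using \<sigma>[OF step(1)] step.IH by (intro mult_left_mono) auto
    also have "\<dots> \<le> exp (- (\<gamma> * \<sigma> n)) * (exp (- \<gamma> * (V n - V N)) * M)"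
      using exp_ge_add_one_self[of "- (\<gamma> * \<sigma> n)"] by (intro mult_right_mono) (auto simp: M_def)
    also have "\<dots> = exp (- \<gamma> * (V (Suc n) - V N)) * M"
      by (simp add: V_def exp_add[symmetric] mult.assoc[symmetric] algebra_simps)
    finally show ?case .
  qed (simp add: M_def)
  have "filterlim (\<lambda>n. \<gamma> * (- V N + V n)) at_top sequentially"
    using div \<gamma> unfolding V_def
    by (intro filterlim_tendsto_pos_mult_at_top[OF tendsto_const] filterlim_tendsto_add_at_top[OF tendsto_const])
  then have "filterlim (\<lambda>n. - (\<gamma> * (- V N + V n))) at_bot sequentially"
    by (simp add: filterlim_uminus_at_top)
  then have "(\<lambda>n. exp (- (\<gamma> * (- V N + V n)))) \<longlonglongrightarrow> 0"
    by (rule filterlim_compose[OF exp_at_bot])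
  from tendsto_mult_left_zero[OF this, of M]
  have "(\<lambda>n. exp (- \<gamma> * (V n - V N)) * M) \<longlonglongrightarrow> 0" by (simp add: algebra_simps)
  then have "eventually (\<lambda>n. exp (- \<gamma> * (V n - V N)) * M < q) sequentially"
    using \<eta> \<gamma> by (intro order_tendstoD(2)) (auto simp: q_def)
  then show ?thesis
    using eventually_ge_at_top[of N]
  proof eventually_elim
    case (elim n)
    have "2 * \<eta> / \<gamma> = q + q" by (simp add: q_def)
    then show ?case using bound[OF elim(2)] elim(1) by linarith
  qed
qed

text \<open>Either \<open>D n\<close> is small, and then so is \<open>b n\<close>, or the descent \<open>\<epsilon> * D n\<close> absorbs \<open>\<sigma> n * b n\<close>.
  So no passage to subsequences is needed.\<close>

lemma descent_recursion_tendsto_0: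
  fixes s \<sigma> b D :: "nat \<Rightarrow> real"
  assumes rec: "eventually (\<lambda>n. s (Suc n) + \<epsilon> * D n \<le> (1 - \<gamma> * \<sigma> n) * s n + \<sigma> n * b n) sequentially"
    and s: "eventually (\<lambda>n. 0 \<le> s n) sequentially"
    and D: "\<And>n. 0 \<le> D n"
    and \<sigma>: "eventually (\<lambda>n. 0 \<le> \<sigma> n) sequentially" "\<sigma> \<longlonglongrightarrow> 0"
    and pos: "\<gamma> > 0" "\<epsilon> > 0"
    and b: "eventually (\<lambda>n. b n \<le> M) sequentially"
    and small: "\<And>\<eta>. \<eta> > 0 \<Longrightarrow> \<exists>\<tau>>0. eventually (\<lambda>n. D n \<le> \<tau> \<longrightarrow> b n \<le> \<eta>) sequentially"
    and div: "filterlim (\<lambda>n. \<Sum>k<n. \<sigma> k) at_top sequentially"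
  shows "s \<longlonglongrightarrow> 0"
proof (rule order_tendstoI)
  fix a :: real assume "a < 0"
  then show "eventually (\<lambda>n. a < s n) sequentially" using s by (auto elim: eventually_mono)
next
  fix a :: real assume a: "0 < a"
  define \<eta> where "\<eta> = a * \<gamma> / 2"
  have \<eta>: "\<eta> > 0" using a pos by (simp add: \<eta>_def)
  obtain \<tau> where \<tau>: "\<tau> > 0" "eventually (\<lambda>n. D n \<le> \<tau> \<longrightarrow> b n \<le> \<eta>) sequentially"
    using small[OF \<eta>] by blast
  have ev: "eventually (\<lambda>n. \<sigma> n * M < \<epsilon> * \<tau>) sequentially"
    using tendsto_mult_left_zero[OF \<sigma>(2), of M] pos \<tau> by (intro order_tendstoD(2)) auto
  have ev1: "eventually (\<lambda>n. \<gamma> * \<sigma> n < 1) sequentially"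
    using tendsto_mult_right_zero[OF \<sigma>(2), of \<gamma>] by (intro order_tendstoD(2)) auto
  have "eventually (\<lambda>n. s (Suc n) \<le> (1 - \<gamma> * \<sigma> n) * s n + \<sigma> n * \<eta>) sequentially"
    using rec \<sigma>(1) b \<tau>(2) ev
  proof eventually_elim
    case (elim n)
    show ?case
    proof (cases "D n \<le> \<tau>")
      case True
      then have "\<sigma> n * b n \<le> \<sigma> n * \<eta>" using elim by (intro mult_left_mono) auto
      moreover have "0 \<le> \<epsilon> * D n" using D[of n] pos by simp
      ultimately show ?thesis using elim(1) by linarith
    next
      case False
      then have "\<epsilon> * \<tau> \<le> \<epsilon> * D n" using pos by simp
      moreover have "\<sigma> n * b n \<le> \<sigma> n * M" using elim by (intro mult_left_mono) auto
      moreover have "0 \<le> \<sigma> n * \<eta>" using elim \<eta> by simp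
      ultimately show ?thesis using elim(1) elim(5) by linarith
    qed
  qed
  moreover have "eventually (\<lambda>n. 0 \<le> \<sigma> n \<and> \<gamma> * \<sigma> n \<le> 1) sequentially"
    using \<sigma>(1) ev1 by eventually_elim auto
  ultimately have "eventually (\<lambda>n. s n < 2 * \<eta> / \<gamma>) sequentially"
    using relaxed_recursion_eventually_le pos(1) \<eta> div by blast
  moreover have "2 * \<eta> / \<gamma> = a" using pos by (simp add: \<eta>_def)
  ultimately show "eventually (\<lambda>n. s n < a) sequentially" by simp
qed

text \<open>By the Lipschitz bound the quotient in the update is at least \<open>r / L\<close>,
  which gives the lower bound. Subtracting the partial sums of \<open>c\<close> leaves a decreasing
  sequence bounded below, hence convergence.\<close>

lemma adaptive_step_sizes:
  fixes \<delta> c :: "nat \<Rightarrow> real" and T :: "'a::real_normed_vector \<Rightarrow> 'b::real_normed_vector"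
  assumes L: "L > 0" "L-lipschitz_on UNIV T" and r: "r > 0" and \<delta>1: "\<delta> 1 > 0"
    and c: "\<And>n. n \<ge> 1 \<Longrightarrow> c n \<ge> 0" "summable (\<lambda>n. c (n + 1))"
    and upd: "\<And>n. n \<ge> 1 \<Longrightarrow>
      \<delta> (n + 1) =
        (if T (w n) \<noteq> T (w (n + 1))
         then min (r * norm (w n - w (n + 1)) / norm (T (w n) - T (w (n + 1)))) (\<delta> n + c n)
         else \<delta> n + c n)"
  shows "\<exists>m>0. \<forall>n\<ge>1. m \<le> \<delta> n" (is ?lower)
    and "convergent \<delta>"
    and "n \<ge> 1 \<Longrightarrow> \<delta> (Suc n) * norm (T (w (Suc n)) - T (w n)) \<le> r * norm (w (Suc n) - w n)"
proof -
  define m where "m = min (r / L) (\<delta> 1)"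
  have m: "m > 0" using r L \<delta>1 by (simp add: m_def)
  have lower: "m \<le> \<delta> n" if "n \<ge> 1" for n
    using that
  proof (induction n rule: dec_induct)
    case (step n)
    have "m \<le> r * norm (w n - w (n + 1)) / norm (T (w n) - T (w (n + 1)))"
      if ne: "T (w n) \<noteq> T (w (n + 1))"
    proof -
      have "m * norm (T (w n) - T (w (n + 1))) \<le> (r / L) * (L * norm (w n - w (n + 1)))"
        using lipschitz_onD[OF L(2)] r L m by (intro mult_mono) (auto simp: m_def dist_norm)
      then show ?thesis using ne L by (simp add: field_simps)
    qed
    then show ?case using upd[OF step(1)] c(1)[OF step(1)] step.IH by simp
  qed (simp add: m_def)
  then show ?lower using m by blast
  show "\<delta> (Suc n) * norm (T (w (Suc n)) - T (w n)) \<le> r * norm (w (Suc n) - w n)" if "n \<ge> 1"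
  proof (cases "T (w n) = T (w (Suc n))")
    case True
    then show ?thesis using r by simp
  next
    case False
    then have "\<delta> (Suc n) \<le> r * norm (w n - w (Suc n)) / norm (T (w n) - T (w (Suc n)))"
      using upd[OF that] by simp
    moreover have "norm (T (w n) - T (w (Suc n))) > 0" using False by simp
    ultimately show ?thesis by (simp add: pos_le_divide_eq norm_minus_commute)
  qed
  define g where "g = (\<lambda>n. \<delta> (Suc n) - (\<Sum>k<n. c (k + 1)))"
  have "decseq g"
    unfolding decseq_Suc_iff
  proof
    fix n
    have "\<delta> (Suc (Suc n)) \<le> \<delta> (Suc n) + c (Suc n)" using upd[of "Suc n"] by simp
    then show "g (Suc n) \<le> g n" by (simp add: g_def)
  qed
  moreover have "m - (\<Sum>k. c (k + 1)) \<le> g n" for n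
  proof -
    have "(\<Sum>k<n. c (k + 1)) \<le> (\<Sum>k. c (k + 1))" using c by (intro sum_le_suminf) auto
    then show ?thesis using lower[of "Suc n"] unfolding g_def by simp
  qed
  ultimately have "convergent g" using decseq_convergent convergentI by metis
  moreover have "convergent (\<lambda>n. \<Sum>k<n. c (k + 1))" using c(2) by (simp add: summable_iff_convergent)
  ultimately have "convergent (\<lambda>n. g n + (\<Sum>k<n. c (k + 1)))" by (rule convergent_add)
  then have "convergent (\<lambda>n. \<delta> (Suc n))" by (simp add: g_def)
  then show "convergent \<delta>" by (simp only: convergent_Suc_iff)
qed

subsection \<open>Strong convergence\<close>

theorem theorem5p3:
  fixes S :: "'a::{real_inner, complete_space} \<Rightarrow> 'a set"
    and T U :: "'a \<Rightarrow> 'a"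
    and L \<kappa> \<beta> r :: real
    and \<delta> \<sigma> c :: "nat \<Rightarrow> real"
    and w :: "nat \<Rightarrow> 'a"
  assumes "maximal_monotone S"
    and "monotone_point_map T"
    and "L > 0" and "L-lipschitz_on UNIV T"
    and "operator_inverse (operator_plus S T) 0 \<noteq> {}"
    and "0 \<le> \<kappa>" and "\<kappa> < 1/2" and "\<kappa>-lipschitz_on UNIV U"
    and "\<delta> 0 > 0" and "\<delta> 1 > 0"
    and "0 < \<beta>" and "\<beta> < 1/4"
    and "\<beta> < r" and "r < (1 - 2 * \<beta>) / 2"
    and "\<And>n. n \<ge> 1 \<Longrightarrow> 0 < \<sigma> n \<and> \<sigma> n < 1"
    and "\<And>n. n \<ge> 1 \<Longrightarrow> c n \<ge> 0"
    and "summable (\<lambda>n. c (n + 1))"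
    and "\<And>n. n \<ge> 1 \<Longrightarrow>
      w (n + 1) = resolvent S (\<delta> n)
        (\<sigma> n *\<^sub>R U (w n) + (1 - \<sigma> n) *\<^sub>R w n - \<delta> n *\<^sub>R T (w n)
          - (\<delta> (n - 1) * (1 - \<sigma> n * (1 - 2 * \<kappa>))) *\<^sub>R (T (w n) - T (w (n - 1))))"
    and "\<And>n. n \<ge> 1 \<Longrightarrow>
      \<delta> (n + 1) =
        (if T (w n) \<noteq> T (w (n + 1))
         then min (r * norm (w n - w (n + 1)) / norm (T (w n) - T (w (n + 1)))) (\<delta> n + c n)
         else \<delta> n + c n)"
    and "\<sigma> \<longlonglongrightarrow> 0"
    and "filterlim (\<lambda>N. \<Sum>n=1..N. \<sigma> n) at_top sequentially"
  shows "\<exists>p. p = metric_projection (operator_inverse (operator_plus S T) 0) (U p)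
           \<and> (\<forall>q. q = metric_projection (operator_inverse (operator_plus S T) 0) (U q) \<longrightarrow> q = p)
           \<and> w \<longlonglongrightarrow> p"
proof -
  note S = assms(1) and T = assms(2) and L = assms(3,4) and \<kappa> = assms(6,7) and U = assms(8)
    and r = assms(11,13,14) and \<sigma> = assms(15) and c = assms(16,17) and w_upd = assms(18)
    and \<delta>_upd = assms(19) and \<sigma>0 = assms(20)

  \<comment> \<open>The projected fixed point and its regularized approximants\<close>
  define C where "C = operator_inverse (operator_plus S T) 0"
  have C: "C = operator_inverse (operator_plus S T) 0" "C \<noteq> {}" using assms(5) by (simp_all add: C_def)
  have mono: "monotone_operator S" by (rule maximal_monotone_imp_monotone[OF S])
  have "\<exists>q. q \<in> C \<and> (\<forall>z\<in>C. inner (u - q) (z - q) \<le> 0)" for u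
    by (rule tikhonov[OF S T L(2) C, of u]) blast
  then obtain P where P: "\<And>u. P u \<in> C" "\<And>u z. z \<in> C \<Longrightarrow> inner (u - P u) (z - P u) \<le> 0"
    by metis
  have mp: "metric_projection C u = P u" for u using P by (intro metric_projection_eqI)
  have "dist (P (U a)) (P (U b)) \<le> \<kappa> * dist a b" for a b
  proof -
    have "dist (P (U a)) (P (U b)) \<le> dist (U a) (U b)"
      using P by (intro variational_nonexpansive)
    then show ?thesis using lipschitz_onD[OF U, of a b] by simp
  qed
  then have "\<exists>!q. P (U q) = q" using \<kappa> by (intro banach_fix_type[of \<kappa>]) auto
  then obtain p where p: "P (U p) = p" and p_unique: "\<And>q. P (U q) = q \<Longrightarrow> q = p" by blast
  obtain x p' where x: "\<And>k. (1 / real (Suc k)) *\<^sub>R (U p - x k) - T (x k) \<in> S (x k)"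
    and xp': "x \<longlonglongrightarrow> p'" and p': "p' \<in> C" "\<And>z. z \<in> C \<Longrightarrow> inner (U p - p') (z - p') \<le> 0"
    by (rule tikhonov[OF S T L(2) C, of "U p"]) blast
  \<comment> \<open>The Tikhonov limit for \<open>U p\<close> is the projection of
    \<open>U p\<close>, which is the fixed point itself.\<close>
  have "p' = p" using metric_projection_eqI[OF p'] mp p by simp
  then have xp: "x \<longlonglongrightarrow> p" and pC: "p \<in> C" using xp' p' by simp_all
  have Tp: "- T p \<in> S p" using pC C mem_zeros_iff by blast

  \<comment> \<open>Constants and asymptotics of the step sizes\<close>
  define h where "h = (1 / 2 - r) / 6"
  \<comment> \<open>The bounds on \<open>\<beta>\<close> give \<open>r < 1 / 2\<close>, and
    \<open>6 * h\<close> is the gap. Then \<open>\<rho>\<close> stays below \<open>1 / 2\<close>,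
    \<open>s\<close> exceeds \<open>\<rho>\<close> by \<open>2 * h\<close>, and
    \<open>1 - \<rho> - s = 6 * h\<close> leaves one \<open>h\<close> for the descent and
    \<open>5 * h\<close> for the vanishing weights.\<close>
  define \<rho> where "\<rho> = r + 2 * h"
  define s where "s = r + 4 * h"
  have r0: "0 < r" and h0: "0 < h" and r_eq: "r = 1 / 2 - 6 * h" using r by (simp_all add: h_def field_simps)
  have \<rho>0: "0 < \<rho>" "r < \<rho>" and \<rho>_half: "\<rho> < 1 / 2" and \<rho>s: "\<rho> < s" and sum: "1 - \<rho> - s = 6 * h"
    and s\<rho>: "s - \<rho> = 2 * h"
    using r0 h0 r_eq unfolding \<rho>_def s_def by linarith+

  note step_sizes = adaptive_step_sizes[of L T r \<delta> c w, OF L r0 assms(10) c(1) c(2) \<delta>_upd, simplified]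
  obtain m where m: "m > 0" "\<And>n. n \<ge> 1 \<Longrightarrow> m \<le> \<delta> n"
    using step_sizes(1) by auto
  have conv: "convergent \<delta>" by (rule step_sizes(2))
  have step: "\<delta> (Suc n) * norm (T (w (Suc n)) - T (w n)) \<le> r * norm (w (Suc n) - w n)" if "n \<ge> 1" for n
    by (rule step_sizes(3)) (use that in simp)
  have \<delta>0: "0 < \<delta> n" for n
    using m(1) m(2)[of n] assms(9) by (cases "n = 0") auto
  \<comment> \<open>From here on, index \<open>k\<close> stands for the iteration step \<open>n = k + 1\<close>.\<close>
  define A where "A = (\<lambda>k. T (w (Suc k)) - T (w k))"
  \<comment> \<open>The update rule controls \<open>\<delta> (Suc k) * norm (A k)\<close>, but the
    iteration contains \<open>\<delta> k\<close>. The step sizes have a positive limit, so enlarging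
    \<open>r\<close> to \<open>\<rho>\<close> eventually absorbs the change of index.\<close>
  have evA: "eventually (\<lambda>k. \<delta> k * norm (A k) \<le> \<rho> * norm (w (Suc k) - w k)) sequentially"
  proof -
    obtain l where l: "\<delta> \<longlonglongrightarrow> l" using conv convergent_def by blast
    have "m \<le> l" using m(2) by (intro LIMSEQ_le_const[OF l]) blast
    then have "0 < \<rho> * l - r * l" using m(1) \<rho>0 by (simp add: left_diff_distrib[symmetric])
    moreover have "(\<lambda>k. \<rho> * \<delta> (Suc k) - r * \<delta> k) \<longlonglongrightarrow> \<rho> * l - r * l"
      by (intro tendsto_intros l LIMSEQ_Suc)
    ultimately have "eventually (\<lambda>k. 0 < \<rho> * \<delta> (Suc k) - r * \<delta> k) sequentially"
      by (intro order_tendstoD(1))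
    then show ?thesis
      using eventually_ge_at_top[of 1]
    proof eventually_elim
      case (elim k)
      have "r * \<delta> k * norm (A k) \<le> \<rho> * \<delta> (Suc k) * norm (A k)"
        using elim by (intro mult_right_mono) auto
      also have "\<dots> = \<rho> * (\<delta> (Suc k) * norm (A k))" by simp
      also have "\<dots> \<le> \<rho> * (r * norm (w (Suc k) - w k))"
        using step[OF elim(2)] \<rho>0 unfolding A_def by (intro mult_left_mono) auto
      finally have "r * (\<delta> k * norm (A k)) \<le> r * (\<rho> * norm (w (Suc k) - w k))" by (simp add: ac_simps)
      then show ?case using r0 by simp
    qed
  qed

  \<comment> \<open>Relaxation weights and resolvent inclusions\<close>
  define \<tau> where "\<tau> = (\<lambda>k. \<sigma> (Suc k))"
  have \<tau>: "0 < \<tau> k" "\<tau> k < 1" for k using \<sigma>[of "Suc k"] by (simp_all add: \<tau>_def)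
  have \<tau>0: "\<tau> \<longlonglongrightarrow> 0" using LIMSEQ_Suc[OF \<sigma>0] by (simp add: \<tau>_def)
  have div: "filterlim (\<lambda>n. \<Sum>k<n. \<tau> k) at_top sequentially"
    using assms(21) by (simp add: \<tau>_def sum.atLeast1_atMost_eq)
  define \<gamma> where "\<gamma> = 1 - 2 * \<kappa>"
  have \<gamma>: "0 < \<gamma>" "\<gamma> \<le> 1" using \<kappa> by (simp_all add: \<gamma>_def)
  define \<theta> where "\<theta> = (\<lambda>k. 1 - \<tau> k * (1 - 2 * \<kappa>))"
  have \<gamma>\<tau>: "\<gamma> * \<tau> k \<le> \<tau> k" "0 \<le> \<gamma> * \<tau> k" for k
    using \<gamma> \<tau>[of k] mult_right_mono[of \<gamma> 1 "\<tau> k"] by simp_all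
  have \<theta>_eq: "\<theta> k = 1 - \<gamma> * \<tau> k" for k by (simp add: \<theta>_def \<gamma>_def)
  have \<theta>: "0 \<le> \<theta> k" "\<theta> k \<le> 1" "1 - \<tau> k \<le> \<theta> k" for k
    using \<gamma>\<tau>[of k] \<tau>[of k] unfolding \<theta>_eq by linarith+
  have "\<exists>v. v \<in> S (w (Suc (Suc k))) \<and> w (Suc (Suc k)) + \<delta> (Suc k) *\<^sub>R v
      = \<tau> k *\<^sub>R U (w (Suc k)) + (1 - \<tau> k) *\<^sub>R w (Suc k) - \<delta> (Suc k) *\<^sub>R T (w (Suc k))
        - (\<delta> k * \<theta> k) *\<^sub>R A k" for k
    using w_upd[of "Suc k"] resolvent_mem[OF S \<delta>0[of "Suc k"]]
    unfolding \<tau>_def \<theta>_def A_def by (metis Suc_eq_plus1 diff_Suc_1 le_add2)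
  then obtain v where v: "\<And>k. v k \<in> S (w (Suc (Suc k)))"
    and v_eq: "\<And>k. w (Suc (Suc k)) + \<delta> (Suc k) *\<^sub>R v k
      = \<tau> k *\<^sub>R U (w (Suc k)) + (1 - \<tau> k) *\<^sub>R w (Suc k) - \<delta> (Suc k) *\<^sub>R T (w (Suc k))
        - (\<delta> k * \<theta> k) *\<^sub>R A k" by metis

  \<comment> \<open>Lyapunov function and its descent\<close>
  define \<Gamma> where "\<Gamma> = (\<lambda>k. (norm (w (Suc k) - p))\<^sup>2 - 2 * \<delta> k * inner (A k) (w (Suc k) - p)
      + s * (norm (w (Suc k) - w k))\<^sup>2)"
  define D where "D = (\<lambda>k. (norm (w (Suc (Suc k)) - w (Suc k)))\<^sup>2 + (norm (w (Suc k) - w k))\<^sup>2)"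
  define b where "b = (\<lambda>k. 2 * inner (U p - p) (w (Suc (Suc k)) - p))"
  \<comment> \<open>Young's inequality splits the cross term: \<open>\<rho> < 1 / 2\<close>
    preserves half of the squared distance, and \<open>\<rho> < s\<close> covers the increment
    part.\<close>
  have \<Gamma>_ge: "eventually (\<lambda>k. (norm (w (Suc k) - p))\<^sup>2 \<le> 2 * \<Gamma> k) sequentially"
    using evA
  proof eventually_elim
    case (elim k)
    define a where "a = (norm (w (Suc k) - p))\<^sup>2"
    define d where "d = (norm (w (Suc k) - w k))\<^sup>2"
    have "norm (\<delta> k *\<^sub>R A k) \<le> \<rho> * norm (w (Suc k) - w k)" using elim \<delta>0[of k] by simp
    from two_inner_le[OF this less_imp_le[OF \<rho>0(1)], of "w (Suc k) - p"]
    have "2 * \<delta> k * inner (A k) (w (Suc k) - p) \<le> \<rho> * (d + a)" by (simp add: a_def d_def)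
    moreover have "\<rho> * a \<le> 1 / 2 * a"
      using \<rho>_half by (intro mult_right_mono) (auto simp: a_def)
    moreover have "\<rho> * d \<le> s * d"
      using \<rho>s by (intro mult_right_mono) (auto simp: d_def)
    moreover have "\<Gamma> k = a - 2 * \<delta> k * inner (A k) (w (Suc k) - p) + s * d"
      by (simp add: \<Gamma>_def a_def d_def)
    ultimately have "a \<le> 2 * \<Gamma> k" unfolding distrib_left by linarith
    then show ?case by (simp add: a_def)
  qed
  have \<tau>_small: "eventually (\<lambda>k. \<tau> k < \<mu>) sequentially" if "\<mu> > 0" for \<mu>
    using order_tendstoD(2)[OF \<tau>0 that] .
  \<comment> \<open>The term with \<open>1 - \<kappa>\<close> is kept for the boundedness argument
    and dropped in the limit argument.\<close>
  have rec: "eventually (\<lambda>k. \<Gamma> (Suc k) + h * D k + \<tau> k * ((1 - \<kappa>) * (norm (w (Suc (Suc k)) - p))\<^sup>2)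
      \<le> (1 - \<gamma> * \<tau> k) * \<Gamma> k + \<tau> k * b k) sequentially"
    using evA \<tau>_small[of "5 * h", simplified, OF h0] \<tau>_small[of "1 / 2", simplified]
  proof eventually_elim
    case (elim k)
    define d where "d = (norm (w (Suc k) - w k))\<^sup>2"
    define d' where "d' = (norm (w (Suc (Suc k)) - w (Suc k)))\<^sup>2"
    define E where "E = (norm (w (Suc (Suc k)) - p))\<^sup>2"
    \<comment> \<open>The vector is \<open>\<delta> (Suc k)\<close> times the difference of
      \<open>v k\<close> and \<open>- T p\<close>, which lie in the values of \<open>S\<close> at
      \<open>w (Suc (Suc k))\<close> and \<open>p\<close>.\<close>
    have incl: "0 \<le> inner (\<tau> k *\<^sub>R U (w (Suc k)) + (1 - \<tau> k) *\<^sub>R w (Suc k) - w (Suc (Suc k))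
        - \<delta> (Suc k) *\<^sub>R T (w (Suc k)) - (\<delta> k * \<theta> k) *\<^sub>R (T (w (Suc k)) - T (w k))
        + \<delta> (Suc k) *\<^sub>R T p) (w (Suc (Suc k)) - p)"
    proof -
      have "\<tau> k *\<^sub>R U (w (Suc k)) + (1 - \<tau> k) *\<^sub>R w (Suc k) - w (Suc (Suc k))
        - \<delta> (Suc k) *\<^sub>R T (w (Suc k)) - (\<delta> k * \<theta> k) *\<^sub>R (T (w (Suc k)) - T (w k))
        + \<delta> (Suc k) *\<^sub>R T p
        = (w (Suc (Suc k)) + \<delta> (Suc k) *\<^sub>R v k) - w (Suc (Suc k)) + \<delta> (Suc k) *\<^sub>R T p"
        unfolding v_eq A_def by simp
      also have "\<dots> = \<delta> (Suc k) *\<^sub>R (v k - (- T p))" by (simp add: scaleR_right_distrib)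
      finally show ?thesis
        using monotone_operatorD[OF mono v[of k] Tp] \<delta>0[of "Suc k"] by simp
    qed
    have U1: "norm (U (w (Suc k)) - U p) \<le> \<kappa> * norm (w (Suc k) - p)"
      using lipschitz_onD[OF U, of "w (Suc k)" p] by (simp add: dist_norm)
    have T2: "0 \<le> inner (T (w (Suc (Suc k))) - T p) (w (Suc (Suc k)) - p)"
      using T unfolding monotone_point_map_def by blast
    have "E - 2 * \<delta> (Suc k) * inner (A (Suc k)) (w (Suc (Suc k)) - p)
        + (1 - \<tau> k - \<theta> k * \<rho>) * d' + \<tau> k * (1 - \<kappa>) * E
      \<le> \<theta> k * ((norm (w (Suc k) - p))\<^sup>2 - 2 * \<delta> k * inner (A k) (w (Suc k) - p) + \<rho> * d)
        + 2 * \<tau> k * inner (U p - p) (w (Suc (Suc k)) - p)"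
      unfolding E_def d_def d'_def A_def
      by (rule frb_lyapunov_step[OF incl T2 U1])
        (use elim(1) \<tau>[of k] \<kappa> \<theta>[of k] \<delta>0[of k] \<delta>0[of "Suc k"] \<rho>0 in \<open>simp_all add: A_def \<theta>_def\<close>)
    moreover have "\<Gamma> (Suc k) = E - 2 * \<delta> (Suc k) * inner (A (Suc k)) (w (Suc (Suc k)) - p) + s * d'"
      by (simp add: \<Gamma>_def E_def d'_def)
    moreover have "\<theta> k * ((norm (w (Suc k) - p))\<^sup>2 - 2 * \<delta> k * inner (A k) (w (Suc k) - p) + \<rho> * d)
        = \<theta> k * \<Gamma> k - \<theta> k * (s - \<rho>) * d"
      by (simp add: \<Gamma>_def d_def algebra_simps)
    \<comment> \<open>Weighting the old increment by \<open>s\<close> instead of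
      \<open>\<rho>\<close> frees \<open>2 * h * \<theta> k * d\<close>, and
      \<open>\<theta> k\<close> is at least \<open>1 / 2\<close> once
      \<open>\<tau> k < 1 / 2\<close>.\<close>
    moreover have "h * d \<le> \<theta> k * (s - \<rho>) * d"
    proof (rule mult_right_mono)
      have "1 / 2 * (2 * h) \<le> \<theta> k * (2 * h)"
        using elim(3) \<theta>(3)[of k] h0 by (intro mult_right_mono) auto
      then show "h \<le> \<theta> k * (s - \<rho>)" by (simp add: s\<rho>)
    qed (simp add: d_def)
    \<comment> \<open>The new increment pays \<open>s\<close> for the next Lyapunov value and
      \<open>h\<close> for the descent; \<open>\<tau> k < 5 * h\<close> leaves room for
      both.\<close>
    moreover have "(h + s) * d' \<le> (1 - \<tau> k - \<theta> k * \<rho>) * d'"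
    proof (rule mult_right_mono)
      have "\<theta> k * \<rho> \<le> 1 * \<rho>" using \<theta>(2) \<rho>0 by (intro mult_right_mono) auto
      then show "h + s \<le> 1 - \<tau> k - \<theta> k * \<rho>" using elim(2) sum by linarith
    qed (simp add: d'_def)
    moreover have "h * D k = h * d' + h * d" by (simp add: D_def d_def d'_def distrib_left)
    moreover have "2 * \<tau> k * inner (U p - p) (w (Suc (Suc k)) - p) = \<tau> k * b k" by (simp add: b_def)
    ultimately have "\<Gamma> (Suc k) + h * D k + \<tau> k * (1 - \<kappa>) * E \<le> \<theta> k * \<Gamma> k + \<tau> k * b k"
      unfolding distrib_right by linarith
    then show ?case by (simp add: E_def \<theta>_eq mult.assoc)
  qed

  \<comment> \<open>Boundedness of the iterates\<close>
  have D0: "0 \<le> D k" for k by (simp add: D_def)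
  \<comment> \<open>Young's inequality with weight \<open>1 - \<kappa>\<close> matches the unbounded
    part of \<open>b k\<close> with the retained term of \<open>rec\<close>; \<open>K0\<close> is
    the constant left over.\<close>
  define K0 where "K0 = (1 - \<kappa>) * (norm (U p - p) / (1 - \<kappa>))\<^sup>2"
  have "eventually (\<lambda>k. \<Gamma> (Suc k) \<le> (1 - \<gamma> * \<tau> k) * \<Gamma> k + \<tau> k * K0) sequentially"
    using rec
  proof eventually_elim
    case (elim k)
    have "b k \<le> (1 - \<kappa>) * ((norm (U p - p) / (1 - \<kappa>))\<^sup>2 + (norm (w (Suc (Suc k)) - p))\<^sup>2)"
      unfolding b_def using \<kappa> by (intro two_inner_le) auto
    then have "b k \<le> K0 + (1 - \<kappa>) * (norm (w (Suc (Suc k)) - p))\<^sup>2"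
      by (simp add: K0_def distrib_left)
    then have "\<tau> k * b k \<le> \<tau> k * (K0 + (1 - \<kappa>) * (norm (w (Suc (Suc k)) - p))\<^sup>2)"
      using \<tau>[of k] by (intro mult_left_mono) auto
    moreover have "0 \<le> h * D k" using h0 D0[of k] by simp
    ultimately show ?case using elim unfolding distrib_left by linarith
  qed
  then obtain N where N: "\<And>k. k \<ge> N \<Longrightarrow> \<Gamma> (Suc k) \<le> (1 - \<gamma> * \<tau> k) * \<Gamma> k + \<tau> k * K0"
    unfolding eventually_sequentially by blast
  define R where "R = sqrt (2 * max (\<Gamma> N) (K0 / \<gamma>))"
  have bounded: "eventually (\<lambda>k. norm (w (Suc k) - p) \<le> R) sequentially"
    using \<Gamma>_ge eventually_ge_at_top[of N]
  proof eventually_elim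
    case (elim k)
    have "\<Gamma> k \<le> max (\<Gamma> N) (K0 / \<gamma>)"
    proof (rule relaxed_recursion_bounded[where s = \<Gamma> and \<sigma> = \<tau>, OF N])
      show "0 \<le> \<tau> n \<and> \<gamma> * \<tau> n \<le> 1" for n using \<gamma>\<tau>(1)[of n] \<tau>[of n] by linarith
    qed (use \<gamma> elim in auto)
    then have "(norm (w (Suc k) - p))\<^sup>2 \<le> 2 * max (\<Gamma> N) (K0 / \<gamma>)" using elim by linarith
    then show ?case unfolding R_def by (rule real_le_rsqrt)
  qed
  then have bounded2: "eventually (\<lambda>k. norm (w (Suc (Suc k)) - p) \<le> R) sequentially"
    by (simp only: eventually_sequentially_Suc[of "\<lambda>k. norm (w (Suc k) - p) \<le> R"])
  have R0: "0 \<le> R"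
    using bounded unfolding eventually_sequentially by (metis norm_ge_zero order_refl order_trans)

  \<comment> \<open>Vanishing of the Lyapunov function\<close>
  have "\<Gamma> \<longlonglongrightarrow> 0"
  proof (rule descent_recursion_tendsto_0[OF _ _ D0 _ \<tau>0 \<gamma>(1) h0 _ _ div])
    show "eventually (\<lambda>k. \<Gamma> (Suc k) + h * D k \<le> (1 - \<gamma> * \<tau> k) * \<Gamma> k + \<tau> k * b k) sequentially"
      using rec
    proof eventually_elim
      case (elim k)
      have "0 \<le> \<tau> k * ((1 - \<kappa>) * (norm (w (Suc (Suc k)) - p))\<^sup>2)" using \<tau>[of k] \<kappa> by simp
      then show ?case using elim by linarith
    qed
    show "eventually (\<lambda>k. 0 \<le> \<Gamma> k) sequentially"
      using \<Gamma>_ge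
    proof eventually_elim
      case (elim k)
      then show ?case using zero_le_power2[of "norm (w (Suc k) - p)"] by linarith
    qed
    show "eventually (\<lambda>k. 0 \<le> \<tau> k) sequentially" using \<tau>(1) by (simp add: less_imp_le)
    show "eventually (\<lambda>k. b k \<le> 2 * (norm (U p - p) * R)) sequentially"
      using bounded2
    proof eventually_elim
      case (elim k)
      have "inner (U p - p) (w (Suc (Suc k)) - p) \<le> norm (U p - p) * norm (w (Suc (Suc k)) - p)"
        by (rule norm_cauchy_schwarz)
      also have "\<dots> \<le> norm (U p - p) * R" using elim by (intro mult_left_mono) auto
      finally show ?case by (simp add: b_def)
    qed
  next
    fix \<eta> :: real assume \<eta>: "\<eta> > 0"
    obtain \<zeta> where \<zeta>: "\<zeta> > 0" and var: "\<And>y v. v \<in> S y \<Longrightarrow> norm (y - p) \<le> R \<Longrightarrow>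
        norm (v + T y) \<le> \<zeta> \<Longrightarrow> inner (U p - p) (y - p) \<le> \<eta> / 2"
      using approximate_zero_variational[OF mono T x xp half_gt_zero[OF \<eta>] R0] by blast
    \<comment> \<open>\<open>K\<close> bounds \<open>norm (U y - y)\<close> on the ball of radius
      \<open>R\<close> about \<open>p\<close>, \<open>Q\<close> is the constant of
      \<open>frb_residual_bound\<close>, and \<open>\<mu>\<close> is chosen so that
      \<open>Q * \<mu> = \<zeta>\<close>.\<close>
    define K where "K = (\<kappa> + 1) * R + norm (U p - p)"
    define Q where "Q = (K + 1 + \<rho>) / m + L"
    have "0 \<le> K" using \<kappa> R0 by (simp add: K_def)
    then have Q: "Q > 0" using \<rho>0 m L unfolding Q_def by (intro add_nonneg_pos) auto
    define \<mu> where "\<mu> = \<zeta> / Q"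
    have \<mu>: "\<mu> > 0" using \<zeta> Q by (simp add: \<mu>_def)
    \<comment> \<open>The bound on \<open>D k\<close> forces both increments below
      \<open>\<mu>\<close>, and \<open>\<tau> k < \<mu>\<close> holds eventually, so the residual at
      \<open>w (Suc (Suc k))\<close> is at most \<open>\<zeta>\<close>.\<close>
    have "eventually (\<lambda>k. D k \<le> \<mu>\<^sup>2 \<longrightarrow> b k \<le> \<eta>) sequentially"
      using bounded bounded2 evA \<tau>_small[OF \<mu>]
    proof eventually_elim
      case (elim k)
      show ?case
      proof
        assume Dk: "D k \<le> \<mu>\<^sup>2"
        have "(norm (w (Suc (Suc k)) - w (Suc k)))\<^sup>2 \<le> \<mu>\<^sup>2" "(norm (w (Suc k) - w k))\<^sup>2 \<le> \<mu>\<^sup>2"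
          using Dk zero_le_power2[of "norm (w (Suc (Suc k)) - w (Suc k))"]
            zero_le_power2[of "norm (w (Suc k) - w k)"] unfolding D_def by linarith+
        then have n: "norm (w (Suc (Suc k)) - w (Suc k)) \<le> \<mu>" "norm (w (Suc k) - w k) \<le> \<mu>"
          using \<mu> by (auto dest: power2_le_imp_le)
        have "norm (U (w (Suc k)) - U p) \<le> \<kappa> * R"
          using lipschitz_onD[OF U, of "w (Suc k)" p] mult_left_mono[OF elim(1) \<kappa>(1)]
          by (simp add: dist_norm)
        moreover have "norm (U (w (Suc k)) - w (Suc k))
            \<le> norm (U (w (Suc k)) - U p) + norm (U p - p) + norm (w (Suc k) - p)"
          using norm_triangle_ineq[of "U (w (Suc k)) - U p" "U p - p"]
            norm_triangle_ineq4[of "U (w (Suc k)) - p" "w (Suc k) - p"] by simp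
        ultimately have K: "norm (U (w (Suc k)) - w (Suc k)) \<le> K"
          using elim(1) unfolding K_def distrib_right by linarith
        have LT: "norm (T (w (Suc (Suc k))) - T (w (Suc k))) \<le> L * norm (w (Suc (Suc k)) - w (Suc k))"
          using lipschitz_onD[OF L(2)] by (simp add: dist_norm)
        have "norm (v k + T (w (Suc (Suc k)))) \<le> Q * \<mu>"
          unfolding Q_def
          by (rule frb_residual_bound[OF v_eq[unfolded A_def] m(1) m(2) _ _ _ \<theta>(1,2) _ _ K n _ LT])
            (use \<delta>0[of k] \<rho>0 L \<tau>[of k] elim in \<open>simp_all add: A_def\<close>)
        also have "\<dots> = \<zeta>" using Q by (simp add: \<mu>_def)
        finally show "b k \<le> \<eta>" using var[OF v elim(2)] by (simp add: b_def)
      qed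
    qed
    then show "\<exists>\<tau>>0. eventually (\<lambda>k. D k \<le> \<tau> \<longrightarrow> b k \<le> \<eta>) sequentially"
      using \<mu> by (intro exI[of _ "\<mu>\<^sup>2"]) auto
  qed
  then have \<Gamma>0: "(\<lambda>k. 2 * \<Gamma> k) \<longlonglongrightarrow> 0" by (rule tendsto_mult_right_zero)
  have "(\<lambda>k. (norm (w (Suc k) - p))\<^sup>2) \<longlonglongrightarrow> 0"
    by (rule tendsto_sandwich[OF _ \<Gamma>_ge tendsto_const \<Gamma>0]) simp
  then have "(\<lambda>k. sqrt ((norm (w (Suc k) - p))\<^sup>2)) \<longlonglongrightarrow> sqrt 0" by (rule tendsto_real_sqrt)
  then have "(\<lambda>k. norm (w (Suc k) - p)) \<longlonglongrightarrow> 0" by simp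
  then have "(\<lambda>k. w (Suc k) - p) \<longlonglongrightarrow> 0" by (rule tendsto_norm_zero_cancel)
  then have "(\<lambda>k. w (Suc k)) \<longlonglongrightarrow> p" by (rule LIM_zero_cancel)
  then have "w \<longlonglongrightarrow> p" by (rule LIMSEQ_imp_Suc)
  moreover have "q = p" if "q = metric_projection C (U q)" for q
    using that p_unique[of q] by (simp add: mp)
  ultimately show ?thesis
    unfolding C_def[symmetric] using p by (intro exI[of _ p]) (simp add: mp)
qed

end
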